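(* Let $\mathfrak D=(X,U,\mathbb K,\mathsf T)$ be a continuous cdt-MP, let $S\subseteq X$ be compact and let $G\in\mathcal B(X)$ be disjoint from $S$. Assume that for every $x\in X$ $$\mathsf M^*(x;S\,\mathsf U\,G)=\sup_{\pi\in\Pi_S}\mathsf M^\pi(x;S\,\mathsf U\,G),\qquad \mathsf M_*(x;S\,\mathsf U\,G)=\inf_{\pi\in\Pi_S}\mathsf M^\pi(x;S\,\mathsf U\,G).$$ Suppose that $g^*$ is locally uniformly excessive on $S$ and that $g_*$ is locally $\pi'_0$-excessive on $S$ for some stationary policy $\pi'\in\Pi_S$. Then for any $\varepsilon\in(0,1]$ $$\chi^*(\{g^*<\varepsilon\})\le\varepsilon,\qquad \chi_*(\{g_*<\varepsilon\})\le\varepsilon,$$ and the sets $S\setminus\{g^*<\varepsilon\}$ and $S\setminus\{g_*<\varepsilon\}$ are simple.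
   Context: A Borel space is a topological space homeomorphic to a Borel subset of a complete separable metric space; $\mathcal B(Y)$ is its Borel $\sigma$-algebra. A cdt-MP is a tuple $\mathfrak D=(X,U,\mathbb K,\mathsf T)$ with $X,U$ non-empty Borel spaces, $\mathbb K\subseteq X\times U$ an analytic set such that $\mathbb K_x:=\{u\in U:(x,u)\in\mathbb K\}\neq\emptyset$ for all $x\in X$, and $\mathsf T(\cdot|x,u)$ a Borel measurable stochastic kernel on $X$ given $X\times U$. It is continuous if $U$ is compact, $\mathbb K$ is closed in $X\times U$, and the restriction $\mathsf T|_{\mathbb K}:\mathbb K\to\mathcal P(X)$ is continuous, where $\mathcal P(X)$ (Borel probability measures on $X$) has the topology of weak convergence. The path space is $H=(X\times U)^{\mathbb N_0}$ and $H_n=(X\times U)^n\times X$ is the space of histories $h_n=(x_0,u_0,\dots,u_{n-1},x_n)$. A policy is a sequence $\pi=(\pi_n)_{n\ge0}$ of universally measurable stochastic kernels $\pi_n$ on $U$ given $H_n$ with $\pi_n(\mathbb K_{x_n}|h_n)=1$ for all $h_n$; $\Pi$ is the set of all policies. A policy is stationary, $\pi\in\Pi_S$, if there is one kernel, denoted $\pi_0(\cdot|x)$, with $\pi_n(\cdot|h_n)=\pi_0(\cdot|x_n)$ for all $n,h_n$ (the subscript in $\Pi_S$ stands for "stationary", not for the set $S$). $\mathsf P^\pi_x$ is the unique probability measure on $H$ under which $x_0=x$, the conditional law of $u_n$ given $h_n$ is $\pi_n(\cdot|h_n)$, and the conditional law of $x_{n+1}$ given $(h_n,u_n)$ is $\mathsf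 T(\cdot|x_n,u_n)$. For an event $A$: $\mathsf M^\pi(x;A)=\mathsf P^\pi_x(A)$, $\mathsf M^*(x;A)=\sup_{\pi\in\Pi}\mathsf M^\pi(x;A)$, $\mathsf M_*(x;A)=\inf_{\pi\in\Pi}\mathsf M^\pi(x;A)$. $S\,\mathsf U\,G$ is the event that there is $i\in\mathbb N_0$ with $x_i\in G$ and $x_j\in S$ for all $0\le j<i$. $\square^nA$ is the event that $x_k\in A$ for all $k\le n$. For $A\in\mathcal B(X)$: $A_\infty=\bigcap_{n\in\mathbb N_0}\{x\in X:\mathsf M^*(x;\square^nA)=1\}$. For Borel $C\subseteq S$: $$\chi^*(C)=\sup_{\pi\in\Pi_S}\sup_{y\in C}\mathsf M^\pi(y;S\,\mathsf U\,G),\qquad \chi_*(C)=\inf_{\pi\in\Pi_S}\sup_{y\in C}\mathsf M^\pi(y;S\,\mathsf U\,G).$$ A randomized selector is a universally measurable stochastic kernel $\mu$ on $U$ given $X$ with $\mu(\mathbb K_x|x)=1$ for all $x\in X$. A bounded Borel function $g:X\to[0,\infty)$ is locally $\mu$-excessive if $\int_U\int_Xg(x')\mathsf T(dx'|x,u)\mu(du|x)\le g(x)$ for all $x\in\{g\le1\}$; it is locally uniformly excessive if $\int_Xg(x')\mathsf T(dx'|x,u)\le g(x)$ for all $x\in\{g\le1\}$ and $u\in\mathbb K_x$. In either case it is said to be so "on $A$" (for $A\in\mathcal B(X)$) if in addition $A_\infty\subseteq\{g=0\}$, $\{g\le1\}\subseteq A$, and $\{g<\varepsilon\}$ is open for every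 $\varepsilon>0$. A set $A\in\mathcal B(X)$ is weakly absorbing if there is a universally measurable kernel $\mu$ on $U$ given $X$ such that $\mu(\mathbb K_x|x)=1$ and $\int_{\mathbb K_x}\mathsf T(A|x,u)\mu(du|x)=1$ for all $x\in A$. A set in $\mathcal B(X)$ is simple if it has no non-empty weakly absorbing (Borel) subsets. *)

theory Defs
  imports "HOL-Probability.Probability"
begin

section \<open>Borel spaces, analytic sets, universal measurability, weak convergence\<close>

text \<open>The ambient complete separable metric space is carried by a subset of the type \<^typ>\<open>real\<close>.
  This is no restriction: such a space has at most continuum many points, hence it is isometric
  to one whose underlying set consists of reals (with some metric, unrelated to the usual one).\<close>

definition Borel_topspace :: "'a topology \<Rightarrow> bool" where
  "Borel_topspace X \<longleftrightarrow>
    (\<exists>m :: real metric. mcomplete_of m \<and> separable_space (mtopology_of m) \<and>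
      (\<exists>B \<in> sigma_sets (mspace m) {V. openin (mtopology_of m) V}.
         X homeomorphic_space subtopology (mtopology_of m) B))"

text \<open>A set is analytic if it is empty or a continuous image of the Baire space.\<close>

definition analytic_set :: "'a :: topological_space set \<Rightarrow> bool" where
  "analytic_set A \<longleftrightarrow>
    A = {} \<or> (\<exists>f :: (nat \<Rightarrow> nat) \<Rightarrow> 'a. continuous_on UNIV f \<and> range f = A)"

definition universal_algebra :: "'a measure \<Rightarrow> 'a measure" where
  "universal_algebra M =
    sigma (space M)
      {A. A \<subseteq> space M \<and> (\<forall>N. prob_space N \<and> sets N = sets M \<longrightarrow> A \<in> sets (completion N))}"

definition universal_kernel ::
    "'a measure \<Rightarrow> 'b measure \<Rightarrow> ('a \<Rightarrow> 'b measure) \<Rightarrow> bool" where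
  "universal_kernel M N \<kappa> \<longleftrightarrow> \<kappa> \<in> universal_algebra M \<rightarrow>\<^sub>M prob_algebra N"

definition weak_conv_topology :: "'a :: topological_space measure topology" where
  "weak_conv_topology = topology_generated_by
    {{P \<in> space (prob_algebra borel). (\<integral>x. f x \<partial>P) \<in> V} | f (V :: real set).
       continuous_on UNIV f \<and> bounded (range f) \<and> open V}"


section \<open>Controlled discrete-time Markov processes\<close>

text \<open>The spaces \<open>X\<close> and \<open>U\<close> are the types \<^typ>\<open>'x\<close> and \<^typ>\<open>'u\<close> themselves. Their sort
  \<^class>\<open>second_countable_topology\<close> is implied by being a Borel space; it makes the Borel
  sigma-algebra of a product coincide with the product of the Borel sigma-algebras.\<close>

definition cdt_MP ::
    "('x :: second_countable_topology \<times> 'u :: second_countable_topology) set \<Rightarrow>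
     ('x \<times> 'u \<Rightarrow> 'x measure) \<Rightarrow> bool" where
  "cdt_MP K T \<longleftrightarrow>
    Borel_topspace (euclidean :: 'x topology) \<and> Borel_topspace (euclidean :: 'u topology) \<and>
    analytic_set K \<and> (\<forall>x. K `` {x} \<noteq> {}) \<and> T \<in> borel \<rightarrow>\<^sub>M prob_algebra borel"

definition continuous_cdt_MP ::
    "('x :: second_countable_topology \<times> 'u :: second_countable_topology) set \<Rightarrow>
     ('x \<times> 'u \<Rightarrow> 'x measure) \<Rightarrow> bool" where
  "continuous_cdt_MP K T \<longleftrightarrow>
    cdt_MP K T \<and> compact (UNIV :: 'u set) \<and> closed K \<and>
    continuous_map (top_of_set K) weak_conv_topology T"

text \<open>A path is a sequence of pairs \<open>(x\<^sub>k, u\<^sub>k)\<close>. A history \<open>h\<^sub>n\<close> is the pair consisting of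
  \<open>((x\<^sub>0, u\<^sub>0), \<dots>, (x\<^sub>n\<^sub>-\<^sub>1, u\<^sub>n\<^sub>-\<^sub>1))\<close>, as a function on \<open>{..<n}\<close>, and \<open>x\<^sub>n\<close>.\<close>

type_synonym ('x, 'u) path = "nat \<Rightarrow> 'x \<times> 'u"
type_synonym ('x, 'u) hist = "(nat \<Rightarrow> 'x \<times> 'u) \<times> 'x"
type_synonym ('x, 'u) policy = "nat \<Rightarrow> ('x, 'u) hist \<Rightarrow> 'u measure"

definition path_space ::
    "('x :: second_countable_topology, 'u :: second_countable_topology) path measure" where
  "path_space = PiM UNIV (\<lambda>_. borel)"

definition hist_space ::
    "nat \<Rightarrow> ('x :: second_countable_topology, 'u :: second_countable_topology) hist measure" where
  "hist_space n = PiM {..<n} (\<lambda>_. borel) \<Otimes>\<^sub>M borel"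

definition hist :: "nat \<Rightarrow> ('x, 'u) path \<Rightarrow> ('x, 'u) hist" where
  "hist n \<omega> = (restrict \<omega> {..<n}, fst (\<omega> n))"

text \<open>Sections of an analytic set need not be Borel, so measures of \<^term>\<open>K `` {x}\<close> are taken
  with respect to the completion.\<close>

definition policies ::
    "('x :: second_countable_topology \<times> 'u :: second_countable_topology) set \<Rightarrow>
     ('x, 'u) policy set" where
  "policies K = {\<pi>. \<forall>n. universal_kernel (hist_space n) borel (\<pi> n) \<and>
     (\<forall>h \<in> space (hist_space n). emeasure (completion (\<pi> n h)) (K `` {snd h}) = 1)}"

text \<open>Since \<open>H\<^sub>0 = X\<close>, the kernel of a stationary policy \<^term>\<open>\<pi>\<close> is \<^term>\<open>\<pi> 0\<close> itself; the first
  component of a history of length 0 is the empty function.\<close>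

definition initial_kernel :: "('x, 'u) policy \<Rightarrow> 'x \<Rightarrow> 'u measure" where
  "initial_kernel \<pi> x = \<pi> 0 (\<lambda>_. undefined, x)"

definition stationary_policies ::
    "('x :: second_countable_topology \<times> 'u :: second_countable_topology) set \<Rightarrow>
     ('x, 'u) policy set" where
  "stationary_policies K = {\<pi> \<in> policies K.
     \<forall>n. \<forall>h \<in> space (hist_space n). \<pi> n h = initial_kernel \<pi> (snd h)}"

text \<open>Under \<^term>\<open>P\<close>, the conditional law of \<^term>\<open>Y\<close> given the \<^term>\<open>M\<close>-valued variable
  \<^term>\<open>Z\<close> is \<^term>\<open>\<kappa> z\<close> on \<open>Z = z\<close>. The completion is there because \<^term>\<open>\<kappa>\<close> may be
  merely universally measurable.\<close>

definition has_conditional_law ::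
    "'w measure \<Rightarrow> ('w \<Rightarrow> 'b :: topological_space) \<Rightarrow> 'z measure \<Rightarrow> ('w \<Rightarrow> 'z) \<Rightarrow>
     ('z \<Rightarrow> 'b measure) \<Rightarrow> bool" where
  "has_conditional_law P Y M Z \<kappa> \<longleftrightarrow>
    (\<forall>A \<in> sets M. \<forall>B \<in> sets borel.
       emeasure P {\<omega> \<in> space P. Z \<omega> \<in> A \<and> Y \<omega> \<in> B} =
       (\<integral>\<^sup>+\<omega>. indicator A (Z \<omega>) * emeasure (\<kappa> (Z \<omega>)) B \<partial>completion P))"

definition is_path_measure ::
    "('x :: second_countable_topology \<times> 'u :: second_countable_topology \<Rightarrow> 'x measure) \<Rightarrow>
     ('x, 'u) policy \<Rightarrow> 'x \<Rightarrow> ('x, 'u) path measure \<Rightarrow> bool" where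
  "is_path_measure T \<pi> x P \<longleftrightarrow>
    prob_space P \<and> sets P = sets path_space \<and>
    (AE \<omega> in P. fst (\<omega> 0) = x) \<and>
    (\<forall>n. has_conditional_law P (\<lambda>\<omega>. snd (\<omega> n)) (hist_space n) (hist n) (\<pi> n)) \<and>
    (\<forall>n. has_conditional_law P (\<lambda>\<omega>. fst (\<omega> (Suc n)))
           (hist_space n \<Otimes>\<^sub>M borel) (\<lambda>\<omega>. (hist n \<omega>, snd (\<omega> n))) (\<lambda>(h, u). T (snd h, u)))"

definition path_measure ::
    "('x :: second_countable_topology \<times> 'u :: second_countable_topology \<Rightarrow> 'x measure) \<Rightarrow>
     ('x, 'u) policy \<Rightarrow> 'x \<Rightarrow> ('x, 'u) path measure" where
  "path_measure T \<pi> x = (THE P. is_path_measure T \<pi> x P)"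


section \<open>Reachability probabilities\<close>

definition M_val ::
    "('x :: second_countable_topology \<times> 'u :: second_countable_topology \<Rightarrow> 'x measure) \<Rightarrow>
     ('x, 'u) policy \<Rightarrow> 'x \<Rightarrow> ('x, 'u) path set \<Rightarrow> ennreal" where
  "M_val T \<pi> x A = emeasure (path_measure T \<pi> x) A"

definition M_sup ::
    "('x :: second_countable_topology \<times> 'u :: second_countable_topology) set \<Rightarrow>
     ('x \<times> 'u \<Rightarrow> 'x measure) \<Rightarrow> 'x \<Rightarrow> ('x, 'u) path set \<Rightarrow> ennreal" where
  "M_sup K T x A = (SUP \<pi> \<in> policies K. M_val T \<pi> x A)"

definition M_inf ::
    "('x :: second_countable_topology \<times> 'u :: second_countable_topology) set \<Rightarrow>
     ('x \<times> 'u \<Rightarrow> 'x measure) \<Rightarrow> 'x \<Rightarrow> ('x, 'u) path set \<Rightarrow> ennreal" where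
  "M_inf K T x A = (INF \<pi> \<in> policies K. M_val T \<pi> x A)"

definition until_event :: "'x set \<Rightarrow> 'x set \<Rightarrow> ('x, 'u) path set" where
  "until_event S G = {\<omega>. \<exists>i. fst (\<omega> i) \<in> G \<and> (\<forall>j<i. fst (\<omega> j) \<in> S)}"

definition always_event :: "nat \<Rightarrow> 'x set \<Rightarrow> ('x, 'u) path set" where
  "always_event n A = {\<omega>. \<forall>k\<le>n. fst (\<omega> k) \<in> A}"

definition viable_core ::
    "('x :: second_countable_topology \<times> 'u :: second_countable_topology) set \<Rightarrow>
     ('x \<times> 'u \<Rightarrow> 'x measure) \<Rightarrow> 'x set \<Rightarrow> 'x set" where
  "viable_core K T A = (\<Inter>n. {x. M_sup K T x (always_event n A) = 1})"

text \<open>Suprema are taken in \<^typ>\<open>ennreal\<close>, so the supremum over an empty set of states is 0.\<close>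

definition chi_sup ::
    "('x :: second_countable_topology \<times> 'u :: second_countable_topology) set \<Rightarrow>
     ('x \<times> 'u \<Rightarrow> 'x measure) \<Rightarrow> 'x set \<Rightarrow> 'x set \<Rightarrow> 'x set \<Rightarrow> ennreal" where
  "chi_sup K T S G C = (SUP \<pi> \<in> stationary_policies K. SUP y \<in> C. M_val T \<pi> y (until_event S G))"

definition chi_inf ::
    "('x :: second_countable_topology \<times> 'u :: second_countable_topology) set \<Rightarrow>
     ('x \<times> 'u \<Rightarrow> 'x measure) \<Rightarrow> 'x set \<Rightarrow> 'x set \<Rightarrow> 'x set \<Rightarrow> ennreal" where
  "chi_inf K T S G C = (INF \<pi> \<in> stationary_policies K. SUP y \<in> C. M_val T \<pi> y (until_event S G))"


section \<open>Locally excessive functions and simple sets\<close>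

definition randomized_selector ::
    "('x :: second_countable_topology \<times> 'u :: second_countable_topology) set \<Rightarrow>
     ('x \<Rightarrow> 'u measure) \<Rightarrow> bool" where
  "randomized_selector K \<mu> \<longleftrightarrow>
    universal_kernel borel borel \<mu> \<and> (\<forall>x. emeasure (completion (\<mu> x)) (K `` {x}) = 1)"

definition bounded_nonneg_borel :: "('x :: topological_space \<Rightarrow> real) \<Rightarrow> bool" where
  "bounded_nonneg_borel g \<longleftrightarrow>
    g \<in> borel_measurable borel \<and> bounded (range g) \<and> (\<forall>x. 0 \<le> g x)"

definition locally_excessive ::
    "('x :: second_countable_topology \<times> 'u :: second_countable_topology) set \<Rightarrow>
     ('x \<times> 'u \<Rightarrow> 'x measure) \<Rightarrow> ('x \<Rightarrow> 'u measure) \<Rightarrow> ('x \<Rightarrow> real) \<Rightarrow> bool" where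
  "locally_excessive K T \<mu> g \<longleftrightarrow>
    randomized_selector K \<mu> \<and> bounded_nonneg_borel g \<and>
    (\<forall>x \<in> {x. g x \<le> 1}. (\<integral>u. (\<integral>x'. g x' \<partial>T (x, u)) \<partial>\<mu> x) \<le> g x)"

definition locally_uniformly_excessive ::
    "('x :: second_countable_topology \<times> 'u :: second_countable_topology) set \<Rightarrow>
     ('x \<times> 'u \<Rightarrow> 'x measure) \<Rightarrow> ('x \<Rightarrow> real) \<Rightarrow> bool" where
  "locally_uniformly_excessive K T g \<longleftrightarrow>
    bounded_nonneg_borel g \<and>
    (\<forall>x \<in> {x. g x \<le> 1}. \<forall>u \<in> K `` {x}. (\<integral>x'. g x' \<partial>T (x, u)) \<le> g x)"

definition localized_on ::
    "('x :: second_countable_topology \<times> 'u :: second_countable_topology) set \<Rightarrow>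
     ('x \<times> 'u \<Rightarrow> 'x measure) \<Rightarrow> 'x set \<Rightarrow> ('x \<Rightarrow> real) \<Rightarrow> bool" where
  "localized_on K T A g \<longleftrightarrow>
    A \<in> sets borel \<and> viable_core K T A \<subseteq> {x. g x = 0} \<and> {x. g x \<le> 1} \<subseteq> A \<and>
    (\<forall>\<epsilon>>0. open {x. g x < \<epsilon>})"

definition locally_excessive_on ::
    "('x :: second_countable_topology \<times> 'u :: second_countable_topology) set \<Rightarrow>
     ('x \<times> 'u \<Rightarrow> 'x measure) \<Rightarrow> 'x set \<Rightarrow> ('x \<Rightarrow> 'u measure) \<Rightarrow> ('x \<Rightarrow> real) \<Rightarrow> bool" where
  "locally_excessive_on K T A \<mu> g \<longleftrightarrow> locally_excessive K T \<mu> g \<and> localized_on K T A g"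

definition locally_uniformly_excessive_on ::
    "('x :: second_countable_topology \<times> 'u :: second_countable_topology) set \<Rightarrow>
     ('x \<times> 'u \<Rightarrow> 'x measure) \<Rightarrow> 'x set \<Rightarrow> ('x \<Rightarrow> real) \<Rightarrow> bool" where
  "locally_uniformly_excessive_on K T A g \<longleftrightarrow>
    locally_uniformly_excessive K T g \<and> localized_on K T A g"

definition weakly_absorbing ::
    "('x :: second_countable_topology \<times> 'u :: second_countable_topology) set \<Rightarrow>
     ('x \<times> 'u \<Rightarrow> 'x measure) \<Rightarrow> 'x set \<Rightarrow> bool" where
  "weakly_absorbing K T A \<longleftrightarrow>
    A \<in> sets borel \<and>
    (\<exists>\<mu>. universal_kernel borel borel \<mu> \<and>
      (\<forall>x \<in> A. emeasure (completion (\<mu> x)) (K `` {x}) = 1 \<and>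
        (\<integral>\<^sup>+u. indicator (K `` {x}) u * emeasure (T (x, u)) A \<partial>completion (\<mu> x)) = 1))"

definition simple_set ::
    "('x :: second_countable_topology \<times> 'u :: second_countable_topology) set \<Rightarrow>
     ('x \<times> 'u \<Rightarrow> 'x measure) \<Rightarrow> 'x set \<Rightarrow> bool" where
  "simple_set K T A \<longleftrightarrow>
    A \<in> sets borel \<and> (\<forall>B. B \<subseteq> A \<and> weakly_absorbing K T B \<longrightarrow> B = {})"

end

theory Submission
  imports Defs
begin

text \<open>The function \<open>g\<close> controls the reachability probability through a supermartingale argument. As long as
  the state stays in \<open>{g \<le> 1}\<close>, local excessivity says that \<open>g\<close> does not increase on average, under every
  policy for \<open>g\<^sup>*\<close> and under \<open>\<pi>'\<close> for \<open>g\<^sub>*\<close>. Since \<open>{g \<le> 1} \<subseteq> S\<close> and \<open>S\<close> is disjoint from \<open>G\<close>, a path that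
  reaches \<open>G\<close> has left \<open>{g \<le> 1}\<close>. Stopping at the first exit, the probability of this is at most
  the initial value of \<open>g\<close> (\<open>prob_exceeding_one_le\<close>, \<open>M_val_until_le\<close>), which is less than \<open>\<epsilon>\<close> on
  \<open>{g < \<epsilon>}\<close>.

  A weakly absorbing subset \<open>B\<close> of \<open>S \<setminus> {g < \<epsilon>}\<close> can be made invariant by a stationary policy, so that \<open>S\<close> is
  never left from \<open>B\<close> and \<open>B\<close> is contained in the viable core (\<open>weakly_absorbing_subset_viable_core\<close>). But
  \<open>g\<close> vanishes on the viable core, so \<open>B\<close> is empty.

  Both arguments compute with path measures, so most of the work lies in showing that each policy has
  exactly one path measure from each initial state (\<open>path_measure_unique\<close>, \<open>path_measure_exists\<close>). As policies
  are only universally measurable, the theorem of Ionescu Tulcea does not apply to them directly. The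
  remedy is that a universally measurable kernel coincides with a Borel kernel almost everywhere with
  respect to any given law of its argument (\<open>universal_kernel_version\<close>).\<close>

section \<open>Universally measurable kernels\<close>

lemma sets_universal_algebra_subset_completion:
  assumes "prob_space N" "sets N = sets M"
  shows "sets (universal_algebra M) \<subseteq> sets (completion N)"
proof -
  have "sets (universal_algebra M) = sigma_sets (space M)
      {A. A \<subseteq> space M \<and> (\<forall>N. prob_space N \<and> sets N = sets M \<longrightarrow> A \<in> sets (completion N))}"
    unfolding universal_algebra_def by (intro sets_measure_of) auto
  also have "\<dots> \<subseteq> sets (completion N)"
    using assms sets_eq_imp_space_eq[OF assms(2)]
    by (intro sets.sigma_sets_subset'[of _ "completion N" "space M"])
      (auto simp del: sets_completion intro: sets.top[of "completion N", simplified])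
  finally show ?thesis .
qed

lemma space_universal_algebra [simp]: "space (universal_algebra M) = space M"
  unfolding universal_algebra_def by (intro space_measure_of) auto

lemma in_sets_universal_algebra:
  assumes "A \<subseteq> space M"
    and "\<And>N. prob_space N \<Longrightarrow> sets N = sets M \<Longrightarrow> A \<in> sets (completion N)"
  shows "A \<in> sets (universal_algebra M)"
  unfolding universal_algebra_def using assms by (subst sets_measure_of) auto

lemma sets_subset_universal_algebra: "A \<in> sets M \<Longrightarrow> A \<in> sets (universal_algebra M)"
  by (intro in_sets_universal_algebra) (auto dest: sets.sets_into_space)

lemma measurable_completion_of_universal:
  assumes "f \<in> universal_algebra M \<rightarrow>\<^sub>M L" "prob_space N" "sets N = sets M"
  shows "f \<in> completion N \<rightarrow>\<^sub>M L"
  using assms(1) sets_universal_algebra_subset_completion[OF assms(2,3)]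
    sets_eq_imp_space_eq[OF assms(3)]
  by (auto simp: measurable_def)

text \<open>Universal measurability is stable under preimages because every probability measure on the
  domain pushes forward to one on the codomain, and a preimage of a null set for the image
  measure is a null set.\<close>

lemma measurable_universal_algebra:
  assumes f: "f \<in> M \<rightarrow>\<^sub>M N"
  shows "f \<in> universal_algebra M \<rightarrow>\<^sub>M universal_algebra N"
proof (rule measurableI)
  show "x \<in> space (universal_algebra M) \<Longrightarrow> f x \<in> space (universal_algebra N)" for x
    using f by (auto dest: measurable_space)
next
  fix A assume A: "A \<in> sets (universal_algebra N)"
  show "f -` A \<inter> space (universal_algebra M) \<in> sets (universal_algebra M)"
  proof (rule in_sets_universal_algebra)
    fix P assume P: "prob_space P" "sets P = sets M"
    have fP: "f \<in> P \<rightarrow>\<^sub>M N" using f P(2) by (simp cong: measurable_cong_sets)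
    have "A \<in> sets (completion (distr P N f))"
      using sets_universal_algebra_subset_completion[OF prob_space.prob_space_distr[OF P(1) fP]] A
      by auto
    then obtain B Z Z' where BZ: "A = B \<union> Z" "Z \<subseteq> Z'" "Z' \<in> null_sets (distr P N f)" "B \<in> sets N"
      unfolding sets_completion by auto
    have "f -` Z' \<inter> space P \<in> null_sets P"
      using BZ(3) fP by (simp add: null_sets_distr_iff)
    moreover have "f -` B \<inter> space P \<in> sets P" using BZ(4) fP by (auto intro: measurable_sets)
    ultimately have "f -` A \<inter> space P \<in> sets (completion P)"
      using BZ(1,2)
      by (intro sets_completionI[of _ "f -` B \<inter> space P" "f -` Z \<inter> space P" "f -` Z' \<inter> space P"]) auto
    then show "f -` A \<inter> space (universal_algebra M) \<in> sets (completion P)"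
      using sets_eq_imp_space_eq[OF P(2)] by simp
  qed simp
qed

lemma universal_kernel_compose:
  assumes "f \<in> M \<rightarrow>\<^sub>M N" "universal_kernel N L \<kappa>"
  shows "universal_kernel M L (\<lambda>z. \<kappa> (f z))"
  using measurable_compose[OF measurable_universal_algebra[OF assms(1)]] assms(2)
  unfolding universal_kernel_def .

lemma universal_kernel_of_measurable:
  assumes "\<kappa> \<in> M \<rightarrow>\<^sub>M prob_algebra N"
  shows "universal_kernel M N \<kappa>"
  using assms unfolding universal_kernel_def measurable_def
  by (auto intro: sets_subset_universal_algebra)

lemma universal_kernel_if:
  assumes "B \<in> sets M" "universal_kernel M N \<kappa>" "universal_kernel M N \<kappa>'"
  shows "universal_kernel M N (\<lambda>x. if x \<in> B then \<kappa> x else \<kappa>' x)"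
  using assms sets_subset_universal_algebra[OF assms(1)] unfolding universal_kernel_def
  by (intro measurable_If_set) (auto dest: sets.sets_into_space intro: sets.Int)

lemma universal_kernel_prob:
  assumes "universal_kernel M N \<kappa>" "x \<in> space M"
  shows "prob_space (\<kappa> x)" "sets (\<kappa> x) = sets N"
  using measurable_space[of \<kappa> "universal_algebra M" "prob_algebra N" x] assms
  unfolding universal_kernel_def by (auto simp: space_prob_algebra)

text \<open>Countability keeps the exceptional set in the next lemma null; stability under intersections
  makes the values of a probability measure on the generator decide whether a kernel is measurable.\<close>

lemma countable_Int_stable_borel_generator:
  obtains G :: "'a :: second_countable_topology set set"
  where "countable G" "Int_stable G" "sets borel = sigma_sets UNIV G"
proof -
  obtain B :: "'a set set" where B: "countable B" "topological_basis B"
    using ex_countable_basis by blast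
  define G where "G = Inter ` {b. finite b \<and> b \<subseteq> B}"
  have "G \<subseteq> sets borel"
    using topological_basis_open[OF B(2)] by (auto simp: G_def intro!: borel_open open_Inter)
  moreover have "sets borel = sigma_sets UNIV B"
    unfolding borel_eq_countable_basis[OF B] by (simp add: sets_measure_of)
  moreover have "B \<subseteq> G"
  proof
    fix b assume "b \<in> B"
    then show "b \<in> G" unfolding G_def by (intro image_eqI[of _ _ "{b}"]) auto
  qed
  ultimately have "sets borel = sigma_sets UNIV G"
    by (metis sets.sigma_sets_subset sigma_sets_subseteq space_borel subset_antisym)
  moreover have "Int_stable G"
    unfolding Int_stable_def G_def
  proof safe
    fix b c assume "finite b" "finite c" "b \<subseteq> B" "c \<subseteq> B"
    then show "\<Inter> b \<inter> \<Inter> c \<in> Inter ` {b. finite b \<and> b \<subseteq> B}"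
      by (intro image_eqI[of _ _ "b \<union> c"]) auto
  qed
  moreover have "countable G"
    unfolding G_def by (intro countable_image countable_Collect_finite_subset B)
  ultimately show thesis using that by blast
qed

text \<open>This is what makes universally measurable kernels tractable: as long as only one law of the
  argument matters, such a kernel may be replaced by a Borel kernel. On each set of a countable
  generator the kernel agrees almost everywhere with a Borel function; the union of the
  exceptional sets is still null, and there the kernel is replaced by a fixed point mass.\<close>

lemma universal_kernel_version:
  fixes \<kappa> :: "'a \<Rightarrow> 'b :: second_countable_topology measure"
  assumes \<kappa>: "universal_kernel M borel \<kappa>" and N: "N \<in> space (prob_algebra M)"
  obtains \<kappa>' where "\<kappa>' \<in> M \<rightarrow>\<^sub>M prob_algebra borel" "AE z in N. \<kappa>' z = \<kappa> z"
proof -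
  have pN: "prob_space N" and sN[measurable_cong]: "sets N = sets M"
    using N by (auto simp: space_prob_algebra)
  have spN: "space N = space M" using sN by (rule sets_eq_imp_space_eq)
  obtain G :: "'b set set" where G: "countable G" "Int_stable G" "sets borel = sigma_sets UNIV G"
    by (rule countable_Int_stable_borel_generator)
  have "\<exists>f\<in>borel_measurable N. AE z in N. emeasure (\<kappa> z) B = f z" if "B \<in> G" for B
  proof (rule completion_ex_borel_measurable)
    have "B \<in> sets borel" using that G(3) by auto
    moreover have "\<kappa> \<in> completion N \<rightarrow>\<^sub>M subprob_algebra borel"
      using \<kappa> measurable_completion_of_universal[OF _ pN sN]
      unfolding universal_kernel_def by (blast intro: measurable_prob_algebraD)
    ultimately show "(\<lambda>z. emeasure (\<kappa> z) B) \<in> borel_measurable (completion N)"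
      by (intro measurable_compose[OF _ measurable_emeasure_subprob_algebra])
  qed
  then obtain f where f: "\<And>B. B \<in> G \<Longrightarrow> f B \<in> borel_measurable N"
    "\<And>B. B \<in> G \<Longrightarrow> AE z in N. emeasure (\<kappa> z) B = f B z"
    by metis
  have "AE z in N. \<forall>B\<in>G. emeasure (\<kappa> z) B = f B z"
    using f(2) G(1) by (simp add: AE_ball_countable)
  then obtain Z where Z_cover: "{z \<in> space N. \<not> (\<forall>B\<in>G. emeasure (\<kappa> z) B = f B z)} \<subseteq> Z"
      and Z_null: "Z \<in> null_sets N"
    by (auto elim!: AE_E simp: null_sets_def)
  have Z: "emeasure (\<kappa> z) B = f B z" if "z \<in> space M" "z \<notin> Z" "B \<in> G" for z B
    using Z_cover that spN by blast
  have Z_sets[measurable]: "Z \<in> sets N" using Z_null by auto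
  define \<kappa>' where "\<kappa>' z = (if z \<in> Z then return borel undefined else \<kappa> z)" for z
  have "\<kappa>' \<in> M \<rightarrow>\<^sub>M prob_algebra borel"
  proof (rule measurable_prob_algebra_generated[OF G(3,2)])
    fix z assume "z \<in> space M"
    then show "prob_space (\<kappa>' z)" "sets (\<kappa>' z) = sets borel"
      using universal_kernel_prob[OF \<kappa>] by (auto simp: \<kappa>'_def prob_space_return)
  next
    fix B assume B: "B \<in> G"
    then have B': "B \<in> sets borel" using G(3) by auto
    have [measurable]: "f B \<in> borel_measurable N" using f(1) B .
    have "(\<lambda>z. if z \<in> Z then indicator B undefined else f B z) \<in> borel_measurable N"
      by measurable
    also have "?this \<longleftrightarrow> (\<lambda>z. emeasure (\<kappa>' z) B) \<in> borel_measurable M"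
      unfolding measurable_cong_sets[OF sN refl]
      using Z B B' spN by (intro measurable_cong) (auto simp: \<kappa>'_def)
    finally show "(\<lambda>z. emeasure (\<kappa>' z) B) \<in> borel_measurable M" .
  qed simp
  moreover have "AE z in N. \<kappa>' z = \<kappa> z"
    using AE_not_in[OF Z_null] by eventually_elim (simp add: \<kappa>'_def)
  ultimately show thesis using that by blast
qed

section \<open>Conditional laws\<close>

definition joint_law ::
    "'a measure \<Rightarrow> 'a measure \<Rightarrow> ('a \<Rightarrow> 'b :: topological_space measure) \<Rightarrow> ('a \<times> 'b) measure" where
  "joint_law M \<mu> \<kappa> = \<mu> \<bind> (\<lambda>z. \<kappa> z \<bind> (\<lambda>y. return (M \<Otimes>\<^sub>M borel) (z, y)))"

lemma measurable_joint_law_kernel: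
  assumes [measurable]: "\<kappa> \<in> M \<rightarrow>\<^sub>M prob_algebra borel"
  shows "(\<lambda>z. \<kappa> z \<bind> (\<lambda>y. return (M \<Otimes>\<^sub>M borel) (z, y))) \<in> M \<rightarrow>\<^sub>M prob_algebra (M \<Otimes>\<^sub>M borel)"
  by measurable

lemma joint_law_prob:
  assumes "\<mu> \<in> space (prob_algebra M)" "\<kappa> \<in> M \<rightarrow>\<^sub>M prob_algebra borel"
  shows "prob_space (joint_law M \<mu> \<kappa>)" "sets (joint_law M \<mu> \<kappa>) = sets (M \<Otimes>\<^sub>M borel)"
  unfolding joint_law_def
  using prob_space_bind'[OF assms(1) measurable_joint_law_kernel[OF assms(2)]]
    sets_bind'[OF assms(1) measurable_joint_law_kernel[OF assms(2)]] by auto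

lemma nn_integral_joint_law:
  assumes \<mu>: "\<mu> \<in> space (prob_algebra M)"
    and \<kappa>[measurable]: "\<kappa> \<in> M \<rightarrow>\<^sub>M prob_algebra borel"
    and f[measurable]: "f \<in> borel_measurable (M \<Otimes>\<^sub>M borel)"
  shows "(\<integral>\<^sup>+w. f w \<partial>joint_law M \<mu> \<kappa>) = (\<integral>\<^sup>+z. (\<integral>\<^sup>+y. f (z, y) \<partial>\<kappa> z) \<partial>\<mu>)"
proof -
  have s\<mu>[measurable_cong]: "sets \<mu> = sets M" using \<mu> by (simp add: space_prob_algebra)
  have "(\<integral>\<^sup>+w. f w \<partial>joint_law M \<mu> \<kappa>) =
      (\<integral>\<^sup>+z. (\<integral>\<^sup>+w. f w \<partial>(\<kappa> z \<bind> (\<lambda>y. return (M \<Otimes>\<^sub>M borel) (z, y)))) \<partial>\<mu>)"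
    unfolding joint_law_def using measurable_joint_law_kernel[OF \<kappa>]
    by (intro nn_integral_bind[OF f])
      (simp add: measurable_prob_algebraD measurable_cong_sets[OF s\<mu> refl])
  also have "\<dots> = (\<integral>\<^sup>+z. (\<integral>\<^sup>+y. f (z, y) \<partial>\<kappa> z) \<partial>\<mu>)"
  proof (rule nn_integral_cong)
    fix z assume "z \<in> space \<mu>"
    then have z[simp, measurable]: "z \<in> space M" using sets_eq_imp_space_eq[OF s\<mu>] by simp
    have s\<kappa>[measurable_cong]: "sets (\<kappa> z) = sets borel"
      using measurable_space[OF \<kappa> z] by (simp add: space_prob_algebra)
    have "(\<integral>\<^sup>+w. f w \<partial>(\<kappa> z \<bind> (\<lambda>y. return (M \<Otimes>\<^sub>M borel) (z, y)))) =
      (\<integral>\<^sup>+y. (\<integral>\<^sup>+w. f w \<partial>return (M \<Otimes>\<^sub>M borel) (z, y)) \<partial>\<kappa> z)"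
      by (intro nn_integral_bind[OF f]) measurable
    also have "\<dots> = (\<integral>\<^sup>+y. f (z, y) \<partial>\<kappa> z)"
      by (intro nn_integral_cong nn_integral_return) (auto simp: space_pair_measure)
    finally show "(\<integral>\<^sup>+w. f w \<partial>(\<kappa> z \<bind> (\<lambda>y. return (M \<Otimes>\<^sub>M borel) (z, y)))) =
      (\<integral>\<^sup>+y. f (z, y) \<partial>\<kappa> z)" .
  qed
  finally show ?thesis .
qed

lemma emeasure_joint_event:
  assumes "Z \<in> P \<rightarrow>\<^sub>M M" "Y \<in> P \<rightarrow>\<^sub>M N" "A \<in> sets M" "B \<in> sets N"
  shows "emeasure P {\<omega> \<in> space P. Z \<omega> \<in> A \<and> Y \<omega> \<in> B} =
    (\<integral>\<^sup>+\<omega>. indicator A (Z \<omega>) * indicator B (Y \<omega>) \<partial>P)"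
proof -
  have "{\<omega> \<in> space P. Z \<omega> \<in> A \<and> Y \<omega> \<in> B} = (Z -` A \<inter> space P) \<inter> (Y -` B \<inter> space P)" by auto
  also have "\<dots> \<in> sets P" using assms by (intro sets.Int measurable_sets)
  finally have "emeasure P {\<omega> \<in> space P. Z \<omega> \<in> A \<and> Y \<omega> \<in> B} =
      (\<integral>\<^sup>+\<omega>. indicator {\<omega> \<in> space P. Z \<omega> \<in> A \<and> Y \<omega> \<in> B} \<omega> \<partial>P)" by simp
  also have "\<dots> = (\<integral>\<^sup>+\<omega>. indicator A (Z \<omega>) * indicator B (Y \<omega>) \<partial>P)"
    by (intro nn_integral_cong) (auto split: split_indicator)
  finally show ?thesis .
qed

text \<open>The conditional law fixes the joint law on measurable rectangles, which form an
  intersection-stable generator of the product. The Borel version is needed for the right-hand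
  side to be a mixture in the Giry monad.\<close>

lemma distr_pair_eq_joint_law:
  fixes Y :: "'w \<Rightarrow> 'b :: topological_space"
  assumes P: "prob_space P" and Z[measurable]: "Z \<in> P \<rightarrow>\<^sub>M M" and Y[measurable]: "Y \<in> P \<rightarrow>\<^sub>M borel"
    and law: "has_conditional_law P Y M Z \<kappa>"
    and \<kappa>'[measurable]: "\<kappa>' \<in> M \<rightarrow>\<^sub>M prob_algebra borel"
    and version: "AE z in distr P M Z. \<kappa>' z = \<kappa> z"
  shows "distr P (M \<Otimes>\<^sub>M borel) (\<lambda>\<omega>. (Z \<omega>, Y \<omega>)) = joint_law M (distr P M Z) \<kappa>'" (is "?D = ?J")
proof (rule measure_eqI_generator_eq[OF Int_stable_pair_measure_generator[of M borel]])
  have \<mu>: "distr P M Z \<in> space (prob_algebra M)"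
    using prob_space.prob_space_distr[OF P Z] by (simp add: space_prob_algebra)
  show "{a \<times> b |a b. a \<in> sets M \<and> b \<in> sets borel} \<subseteq> Pow (space (M \<Otimes>\<^sub>M borel))"
    by (auto simp: space_pair_measure dest: sets.sets_into_space)
  show "sets ?D = sigma_sets (space (M \<Otimes>\<^sub>M borel)) {a \<times> b |a b. a \<in> sets M \<and> b \<in> sets (borel :: 'b measure)}"
    "sets ?J = sigma_sets (space (M \<Otimes>\<^sub>M borel)) {a \<times> b |a b. a \<in> sets M \<and> b \<in> sets (borel :: 'b measure)}"
    unfolding joint_law_prob[OF \<mu> \<kappa>'] by (simp_all add: sets_pair_measure space_pair_measure)
  show "range (\<lambda>_ :: nat. space (M \<Otimes>\<^sub>M borel)) \<subseteq> {a \<times> b |a b. a \<in> sets M \<and> b \<in> sets (borel :: 'b measure)}"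
    using sets.top[of M] sets.top[of "borel :: 'b measure"]
    unfolding space_pair_measure by blast
  show "(\<Union>i :: nat. space (M \<Otimes>\<^sub>M borel)) = space (M \<Otimes>\<^sub>M (borel :: 'b measure))" by simp
  interpret D: prob_space ?D using P by (intro prob_space.prob_space_distr) measurable
  show "emeasure ?D (space (M \<Otimes>\<^sub>M borel)) \<noteq> \<infinity>" for i :: nat by simp
  fix C assume "C \<in> {a \<times> b |a b. a \<in> sets M \<and> b \<in> sets (borel :: 'b measure)}"
  then obtain A B where C: "C = A \<times> B" and A[measurable]: "A \<in> sets M"
    and B[measurable]: "B \<in> sets borel" by auto
  have "emeasure ?D C = emeasure P {\<omega> \<in> space P. Z \<omega> \<in> A \<and> Y \<omega> \<in> B}"
    unfolding C by (subst emeasure_distr) (auto intro!: arg_cong[where f="emeasure P"])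
  also have "\<dots> = (\<integral>\<^sup>+\<omega>. indicator A (Z \<omega>) * emeasure (\<kappa> (Z \<omega>)) B \<partial>P)"
    using law unfolding has_conditional_law_def nn_integral_completion by simp
  also have "\<dots> = (\<integral>\<^sup>+\<omega>. indicator A (Z \<omega>) * emeasure (\<kappa>' (Z \<omega>)) B \<partial>P)"
    using AE_distrD[OF Z version] by (intro nn_integral_cong_AE) (auto elim!: eventually_mono)
  also have "\<dots> = (\<integral>\<^sup>+z. indicator A z * emeasure (\<kappa>' z) B \<partial>distr P M Z)"
    using measurable_prob_algebraD[OF \<kappa>'] by (subst nn_integral_distr) simp_all
  also have "\<dots> = (\<integral>\<^sup>+z. (\<integral>\<^sup>+y. indicator C (z, y) \<partial>\<kappa>' z) \<partial>distr P M Z)"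
  proof (rule nn_integral_cong)
    fix z assume "z \<in> space (distr P M Z)"
    then have s\<kappa>[measurable_cong]: "sets (\<kappa>' z) = sets borel"
      using measurable_space[OF \<kappa>', of z] by (simp add: space_prob_algebra)
    have "(\<integral>\<^sup>+y. indicator C (z, y) \<partial>\<kappa>' z) = (\<integral>\<^sup>+y. indicator A z * indicator B y \<partial>\<kappa>' z)"
      by (intro nn_integral_cong) (auto simp: C split: split_indicator)
    then show "indicator A z * emeasure (\<kappa>' z) B = (\<integral>\<^sup>+y. indicator C (z, y) \<partial>\<kappa>' z)"
      by (simp add: nn_integral_cmult)
  qed
  also have "\<dots> = (\<integral>\<^sup>+w. indicator C w \<partial>?J)"
    by (intro nn_integral_joint_law[symmetric] \<mu> \<kappa>') (simp add: C)
  also have "\<dots> = emeasure ?J C"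
    using joint_law_prob(2)[OF \<mu> \<kappa>'] by (intro nn_integral_indicator) (simp add: C)
  finally show "emeasure ?D C = emeasure ?J C" .
qed

text \<open>Disintegration with the universally measurable kernel itself: the Borel version used in
  between differs from it only on a null set of the conditioning variable.\<close>

lemma nn_integral_conditional_law:
  fixes Y :: "'w \<Rightarrow> 'b :: second_countable_topology"
  assumes P: "prob_space P" and Z[measurable]: "Z \<in> P \<rightarrow>\<^sub>M M" and Y[measurable]: "Y \<in> P \<rightarrow>\<^sub>M borel"
    and law: "has_conditional_law P Y M Z \<kappa>" and \<kappa>: "universal_kernel M borel \<kappa>"
    and f[measurable]: "f \<in> borel_measurable (M \<Otimes>\<^sub>M borel)"
  shows "(\<integral>\<^sup>+\<omega>. f (Z \<omega>, Y \<omega>) \<partial>P) = (\<integral>\<^sup>+\<omega>. (\<integral>\<^sup>+y. f (Z \<omega>, y) \<partial>\<kappa> (Z \<omega>)) \<partial>P)"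
proof -
  have \<mu>: "distr P M Z \<in> space (prob_algebra M)"
    using prob_space.prob_space_distr[OF P Z] by (simp add: space_prob_algebra)
  obtain \<kappa>' where \<kappa>'[measurable]: "\<kappa>' \<in> M \<rightarrow>\<^sub>M prob_algebra borel"
    and version: "AE z in distr P M Z. \<kappa>' z = \<kappa> z"
    by (rule universal_kernel_version[OF \<kappa> \<mu>])
  have "(\<integral>\<^sup>+\<omega>. f (Z \<omega>, Y \<omega>) \<partial>P) = (\<integral>\<^sup>+w. f w \<partial>distr P (M \<Otimes>\<^sub>M borel) (\<lambda>\<omega>. (Z \<omega>, Y \<omega>)))"
    by (subst nn_integral_distr) simp_all
  also have "\<dots> = (\<integral>\<^sup>+z. (\<integral>\<^sup>+y. f (z, y) \<partial>\<kappa>' z) \<partial>distr P M Z)"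
    unfolding distr_pair_eq_joint_law[OF P Z Y law \<kappa>' version]
    by (rule nn_integral_joint_law[OF \<mu> \<kappa>' f])
  also have "\<dots> = (\<integral>\<^sup>+\<omega>. (\<integral>\<^sup>+y. f (Z \<omega>, y) \<partial>\<kappa>' (Z \<omega>)) \<partial>P)"
    using nn_integral_measurable_subprob_algebra2[OF _ measurable_prob_algebraD[OF \<kappa>'], of "\<lambda>z y. f (z, y)"]
    by (intro nn_integral_distr Z) simp_all
  also have "\<dots> = (\<integral>\<^sup>+\<omega>. (\<integral>\<^sup>+y. f (Z \<omega>, y) \<partial>\<kappa> (Z \<omega>)) \<partial>P)"
    using AE_distrD[OF Z version] by (intro nn_integral_cong_AE) (auto elim!: eventually_mono)
  finally show ?thesis .
qed

text \<open>Two measures that agree on the conditioning variable share a Borel version of the kernel.\<close>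

lemma conditional_law_determines_joint_law:
  fixes Y :: "'w \<Rightarrow> 'b :: second_countable_topology"
  assumes P: "prob_space P" "Z \<in> P \<rightarrow>\<^sub>M M" "Y \<in> P \<rightarrow>\<^sub>M borel" "has_conditional_law P Y M Z \<kappa>"
    and Q: "prob_space Q" "Z \<in> Q \<rightarrow>\<^sub>M M" "Y \<in> Q \<rightarrow>\<^sub>M borel" "has_conditional_law Q Y M Z \<kappa>"
    and \<kappa>: "universal_kernel M borel \<kappa>"
    and eq: "distr P M Z = distr Q M Z"
  shows "distr P (M \<Otimes>\<^sub>M borel) (\<lambda>\<omega>. (Z \<omega>, Y \<omega>)) = distr Q (M \<Otimes>\<^sub>M borel) (\<lambda>\<omega>. (Z \<omega>, Y \<omega>))"
proof -
  have \<mu>: "distr P M Z \<in> space (prob_algebra M)"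
    using prob_space.prob_space_distr[OF P(1,2)] by (simp add: space_prob_algebra)
  obtain \<kappa>' where \<kappa>': "\<kappa>' \<in> M \<rightarrow>\<^sub>M prob_algebra borel" "AE z in distr P M Z. \<kappa>' z = \<kappa> z"
    by (rule universal_kernel_version[OF \<kappa> \<mu>])
  show ?thesis
    using distr_pair_eq_joint_law[OF P \<kappa>'] distr_pair_eq_joint_law[OF Q \<kappa>'[unfolded eq]] eq
    by simp
qed

section \<open>Uniqueness of the path measure\<close>

lemma space_path_space [simp]: "space path_space = UNIV"
  by (simp add: path_space_def space_PiM)

lemma measurable_coordinate [measurable]: "(\<lambda>\<omega>. \<omega> n) \<in> path_space \<rightarrow>\<^sub>M borel"
  unfolding path_space_def by measurable

lemma measurable_state [measurable]:
  "(\<lambda>\<omega> :: ('x :: second_countable_topology, 'u :: second_countable_topology) path. fst (\<omega> n))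
    \<in> path_space \<rightarrow>\<^sub>M borel"
  by (intro measurable_compose[OF measurable_coordinate] borel_measurable_continuous_onI continuous_intros)

lemma measurable_action [measurable]:
  "(\<lambda>\<omega> :: ('x :: second_countable_topology, 'u :: second_countable_topology) path. snd (\<omega> n))
    \<in> path_space \<rightarrow>\<^sub>M borel"
  by (intro measurable_compose[OF measurable_coordinate] borel_measurable_continuous_onI continuous_intros)

lemma measurable_hist [measurable]:
  "hist n \<in> path_space \<rightarrow>\<^sub>M
    (hist_space n :: ('x :: second_countable_topology, 'u :: second_countable_topology) hist measure)"
  unfolding hist_def hist_space_def
  by (intro measurable_Pair measurable_restrict measurable_coordinate measurable_state)

lemma measurable_current_state [measurable]: "snd \<in> hist_space n \<rightarrow>\<^sub>M borel"
  unfolding hist_space_def by measurable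

definition extend_hist :: "nat \<Rightarrow> (('x, 'u) hist \<times> 'u) \<times> 'x \<Rightarrow> ('x, 'u) hist" where
  "extend_hist n = (\<lambda>((h, u), x). ((fst h)(n := (snd h, u)), x))"

lemma measurable_extend_hist [measurable]:
  "extend_hist n \<in> (hist_space n \<Otimes>\<^sub>M borel) \<Otimes>\<^sub>M borel \<rightarrow>\<^sub>M
    (hist_space (Suc n) :: ('x :: second_countable_topology, 'u :: second_countable_topology) hist measure)"
  unfolding hist_space_def extend_hist_def split_beta
proof (intro measurable_Pair)
  show "(\<lambda>z. (fst (fst (fst z)))(n := (snd (fst (fst z)), snd (fst z))))
    \<in> ((Pi\<^sub>M {..<n} (\<lambda>_. borel) \<Otimes>\<^sub>M borel) \<Otimes>\<^sub>M borel) \<Otimes>\<^sub>M borel \<rightarrow>\<^sub>M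
      Pi\<^sub>M {..<Suc n} (\<lambda>_. borel :: ('x \<times> 'u) measure)"
    by (rule measurable_fun_upd[where J="{..<n}"]) (auto intro!: measurable_Pair)
qed measurable

lemma extend_hist_hist:
  "extend_hist n ((hist n \<omega>, snd (\<omega> n)), fst (\<omega> (Suc n))) = hist (Suc n) \<omega>"
  by (auto simp: extend_hist_def hist_def restrict_def fun_eq_iff less_Suc_eq)

lemma measurable_transition:
  fixes T :: "'x :: second_countable_topology \<times> 'u :: second_countable_topology \<Rightarrow> 'x measure"
  assumes T: "T \<in> borel \<rightarrow>\<^sub>M prob_algebra borel"
  shows "(\<lambda>(h, u). T (snd h, u)) \<in> hist_space n \<Otimes>\<^sub>M borel \<rightarrow>\<^sub>M prob_algebra borel"
  unfolding split_beta by (rule measurable_compose[OF _ T]) measurable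

text \<open>The law of each history is determined by induction: extend a history first by the action and
  then by the next state, each time using that conditional laws determine joint laws. The laws of
  the histories are the finite-dimensional marginals, and these determine a measure on path space.\<close>

lemma path_measure_unique:
  fixes T :: "'x :: second_countable_topology \<times> 'u :: second_countable_topology \<Rightarrow> 'x measure"
  assumes T: "T \<in> borel \<rightarrow>\<^sub>M prob_algebra borel" and \<pi>: "\<pi> \<in> policies K"
    and P: "is_path_measure T \<pi> x P" and Q: "is_path_measure T \<pi> x Q"
  shows "P = Q"
proof -
  have pP: "prob_space P" and sP[measurable_cong]: "sets P = sets path_space"
    and pQ: "prob_space Q" and sQ[measurable_cong]: "sets Q = sets path_space"
    using P Q by (auto simp: is_path_measure_def)
  have hist_law: "distr P (hist_space n) (hist n) = distr Q (hist_space n) (hist n)" for n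
  proof (induction n)
    case 0
    have "distr R (hist_space 0) (hist 0) = return (hist_space 0) (\<lambda>_. undefined, x)"
      if R: "is_path_measure T \<pi> x R" for R
    proof -
      have pR: "prob_space R" and sR[measurable_cong]: "sets R = sets path_space"
        and x0: "AE \<omega> in R. fst (\<omega> 0) = x"
        using R by (auto simp: is_path_measure_def)
      have "distr R (hist_space 0) (hist 0) = distr R (hist_space 0) (\<lambda>_. (\<lambda>_. undefined, x))"
      proof (rule distr_cong_AE[OF refl refl])
        show "hist 0 \<in> R \<rightarrow>\<^sub>M hist_space 0" by measurable
        show "AE \<omega> in R. hist 0 \<omega> = (\<lambda>_. undefined, x)"
          using x0 by eventually_elim (auto simp: hist_def restrict_def)
      qed (auto simp: hist_space_def space_pair_measure space_PiM)
      also have "\<dots> = return (hist_space 0) (\<lambda>_. undefined, x)"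
        by (intro prob_space.distr_const pR) (auto simp: hist_space_def space_pair_measure space_PiM)
      finally show ?thesis .
    qed
    then show ?case using P Q by simp
  next
    case (Suc n)
    have \<pi>n: "universal_kernel (hist_space n) borel (\<pi> n)" using \<pi> by (auto simp: policies_def)
    have pair: "distr P (hist_space n \<Otimes>\<^sub>M borel) (\<lambda>\<omega>. (hist n \<omega>, snd (\<omega> n))) =
        distr Q (hist_space n \<Otimes>\<^sub>M borel) (\<lambda>\<omega>. (hist n \<omega>, snd (\<omega> n)))"
      using P Q by (intro conditional_law_determines_joint_law[OF pP _ _ _ pQ _ _ _ \<pi>n Suc.IH])
        (auto simp: is_path_measure_def)
    have triple: "distr P ((hist_space n \<Otimes>\<^sub>M borel) \<Otimes>\<^sub>M borel)
          (\<lambda>\<omega>. ((hist n \<omega>, snd (\<omega> n)), fst (\<omega> (Suc n)))) =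
        distr Q ((hist_space n \<Otimes>\<^sub>M borel) \<Otimes>\<^sub>M borel)
          (\<lambda>\<omega>. ((hist n \<omega>, snd (\<omega> n)), fst (\<omega> (Suc n))))"
      using P Q universal_kernel_of_measurable[OF measurable_transition[OF T]]
      by (intro conditional_law_determines_joint_law[OF pP _ _ _ pQ _ _ _ _ pair])
        (auto simp: is_path_measure_def)
    have extend: "distr R (hist_space (Suc n)) (hist (Suc n)) =
        distr (distr R ((hist_space n \<Otimes>\<^sub>M borel) \<Otimes>\<^sub>M borel)
          (\<lambda>\<omega>. ((hist n \<omega>, snd (\<omega> n)), fst (\<omega> (Suc n))))) (hist_space (Suc n)) (extend_hist n)"
      if [measurable_cong]: "sets R = sets path_space" for R
      by (subst distr_distr) (auto simp: comp_def extend_hist_hist)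
    show ?case unfolding extend[OF sP] extend[OF sQ] triple ..
  qed
  show ?thesis
  proof (rule measure_eqI_PiM_infinite)
    show "sets P = sets (PiM UNIV (\<lambda>_. borel))" "sets Q = sets (PiM UNIV (\<lambda>_. borel))"
      using sP sQ by (simp_all add: path_space_def)
    show "finite_measure P" using pP by (simp add: prob_space_def)
    fix A and J :: "nat set"
    assume J: "finite J" and A: "\<And>i. i \<in> J \<Longrightarrow> A i \<in> sets (borel :: ('x \<times> 'u) measure)"
    obtain n where n: "J \<subseteq> {..<n}" using J by (meson finite_nat_iff_bounded)
    let ?B = "prod_emb {..<n} (\<lambda>_. borel) J (Pi\<^sub>E J A) \<times> (UNIV :: 'x set)"
    have B: "?B \<in> sets (hist_space n)"
      unfolding hist_space_def using J A n by (intro pair_measureI sets_PiM_I) auto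
    have "emeasure R (prod_emb UNIV (\<lambda>_. borel) J (Pi\<^sub>E J A)) =
        emeasure (distr R (hist_space n) (hist n)) ?B"
      if [measurable_cong]: "sets R = sets path_space" for R
    proof -
      have "hist n -` ?B \<inter> space R = prod_emb UNIV (\<lambda>_. borel) J (Pi\<^sub>E J A)"
        using n sets_eq_imp_space_eq[OF that] by (auto simp: prod_emb_def hist_def PiE_iff subset_eq)
      then show ?thesis using B by (subst emeasure_distr) auto
    qed
    then show "emeasure P (prod_emb UNIV (\<lambda>_. borel) J (Pi\<^sub>E J A)) =
        emeasure Q (prod_emb UNIV (\<lambda>_. borel) J (Pi\<^sub>E J A))"
      using hist_law sP sQ by simp
  qed
qed

section \<open>Existence of the path measure\<close>

text \<open>Under a path measure the initial state is almost surely \<open>x\<close>; to read this off from the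
  construction, points have to be Borel. They are closed because a Borel space is metrizable.\<close>

lemma Borel_topspace_closed_singleton:
  assumes "Borel_topspace (euclidean :: 'a :: topological_space topology)"
  shows "closed {x :: 'a}"
proof -
  obtain m :: "real metric" and B where
    "(euclidean :: 'a topology) homeomorphic_space subtopology (mtopology_of m) B"
    using assms by (auto simp: Borel_topspace_def)
  moreover have "Hausdorff_space (subtopology (mtopology_of m) B)"
    by (intro Hausdorff_space_subtopology)
      (simp add: Metric_space.Hausdorff_space_mtopology mtopology_of_def)
  ultimately have "Hausdorff_space (euclidean :: 'a topology)"
    using homeomorphic_Hausdorff_space by blast
  then have "closedin (euclidean :: 'a topology) {x}"
    by (intro closedin_Hausdorff_singleton) auto
  then show ?thesis by (simp only: closed_closedin)
qed

text \<open>The law of the \<open>n\<close>-th state given the first \<open>n\<close> state-action pairs \<open>w\<close>: a point mass at the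
  initial state when there are none.\<close>

definition state_law :: "('x \<times> 'u \<Rightarrow> 'x :: topological_space measure) \<Rightarrow> 'x \<Rightarrow> nat \<Rightarrow> (nat \<Rightarrow> 'x \<times> 'u) \<Rightarrow> 'x measure" where
  "state_law T x n w = (case n of 0 \<Rightarrow> return borel x | Suc m \<Rightarrow> T (w m))"

text \<open>The law of the \<open>n\<close>-th state-action pair given its predecessors. This groups each action with the
  state that precedes it, so that the process becomes a sequence of elements of \<open>X \<times> U\<close> to which the
  theorem of Ionescu Tulcea applies.\<close>

definition step_law ::
    "('x \<times> 'u \<Rightarrow> 'x :: topological_space measure) \<Rightarrow> 'x \<Rightarrow>
     (('x, 'u :: topological_space) hist \<Rightarrow> 'u measure) \<Rightarrow> nat \<Rightarrow> (nat \<Rightarrow> 'x \<times> 'u) \<Rightarrow> ('x \<times> 'u) measure" where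
  "step_law T x \<kappa> n w = joint_law borel (state_law T x n w) (\<lambda>y. \<kappa> (w, y))"

lemma measurable_state_law:
  fixes T :: "'x :: second_countable_topology \<times> 'u :: second_countable_topology \<Rightarrow> 'x measure"
  assumes T: "T \<in> borel \<rightarrow>\<^sub>M prob_algebra borel"
  shows "state_law T x n \<in> PiM {..<n} (\<lambda>_. borel) \<rightarrow>\<^sub>M prob_algebra borel"
proof (cases n)
  case 0
  have "return borel x \<in> space (prob_algebra borel)"
    by (simp add: space_prob_algebra prob_space_return)
  then show ?thesis using 0 by (simp add: state_law_def[abs_def])
next
  case (Suc m)
  have "(\<lambda>w. T (w m)) \<in> PiM {..<n} (\<lambda>_. borel) \<rightarrow>\<^sub>M prob_algebra borel"
    by (intro measurable_compose[OF _ T] measurable_component_singleton) (simp add: Suc)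
  then show ?thesis by (simp add: Suc state_law_def[abs_def])
qed

lemma measurable_step_law:
  fixes T :: "'x :: second_countable_topology \<times> 'u :: second_countable_topology \<Rightarrow> 'x measure"
  assumes T: "T \<in> borel \<rightarrow>\<^sub>M prob_algebra borel"
    and \<kappa>: "\<kappa> \<in> hist_space n \<rightarrow>\<^sub>M prob_algebra borel"
  shows "step_law T x \<kappa> n \<in> PiM {..<n} (\<lambda>_. borel) \<rightarrow>\<^sub>M prob_algebra borel"
proof -
  have [measurable]: "state_law T x n \<in> PiM {..<n} (\<lambda>_. borel) \<rightarrow>\<^sub>M prob_algebra borel"
    by (rule measurable_state_law[OF T])
  have [measurable]: "\<kappa> \<in> PiM {..<n} (\<lambda>_. borel) \<Otimes>\<^sub>M borel \<rightarrow>\<^sub>M prob_algebra borel"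
    using \<kappa> by (simp add: hist_space_def)
  have "step_law T x \<kappa> n \<in> PiM {..<n} (\<lambda>_. borel) \<rightarrow>\<^sub>M prob_algebra (borel \<Otimes>\<^sub>M borel)"
    unfolding step_law_def[abs_def] joint_law_def by measurable
  then show ?thesis by (simp add: borel_prod)
qed

lemma nn_integral_step_law:
  fixes T :: "'x :: second_countable_topology \<times> 'u :: second_countable_topology \<Rightarrow> 'x measure"
  assumes T: "T \<in> borel \<rightarrow>\<^sub>M prob_algebra borel"
    and \<kappa>: "\<kappa> \<in> hist_space n \<rightarrow>\<^sub>M prob_algebra borel"
    and w: "w \<in> space (PiM {..<n} (\<lambda>_. borel))" and f: "f \<in> borel_measurable borel"
  shows "(\<integral>\<^sup>+z. f z \<partial>step_law T x \<kappa> n w) =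
    (\<integral>\<^sup>+y. (\<integral>\<^sup>+u. f (y, u) \<partial>\<kappa> (w, y)) \<partial>state_law T x n w)"
  unfolding step_law_def
proof (rule nn_integral_joint_law)
  show "state_law T x n w \<in> space (prob_algebra borel)"
    using measurable_space[OF measurable_state_law[OF T] w] .
  show "(\<lambda>y. \<kappa> (w, y)) \<in> borel \<rightarrow>\<^sub>M prob_algebra borel"
    using w by (intro measurable_compose[OF _ \<kappa>]) (simp add: hist_space_def)
  show "f \<in> borel_measurable (borel \<Otimes>\<^sub>M borel)" using f by (simp add: borel_prod)
qed

text \<open>A Borel version of \<open>\<pi> n\<close> has to be chosen with respect to the law of the \<open>n\<close>-th history, which in
  turn depends on the versions chosen before. Hence the law \<open>\<eta> n\<close> of the first \<open>n\<close> state-action pairs and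
  the version \<open>\<kappa> n\<close> are constructed together by dependent choice.\<close>

lemma exists_versions_along_prefix_laws:
  fixes T :: "'x :: second_countable_topology \<times> 'u :: second_countable_topology \<Rightarrow> 'x measure"
  assumes T: "T \<in> borel \<rightarrow>\<^sub>M prob_algebra borel"
    and \<pi>: "\<And>n. universal_kernel (hist_space n) borel (\<pi> n)"
  obtains \<eta> :: "nat \<Rightarrow> (nat \<Rightarrow> 'x \<times> 'u) measure" and \<kappa> :: "('x, 'u) policy"
  where "\<And>n. \<kappa> n \<in> hist_space n \<rightarrow>\<^sub>M prob_algebra borel"
    and "\<eta> 0 = return (PiM {..<0} (\<lambda>_. borel)) (\<lambda>_. undefined)"
    and "\<And>n. \<eta> (Suc n) =
      \<eta> n \<bind> (\<lambda>w. distr (step_law T x (\<kappa> n) n w) (PiM {..<Suc n} (\<lambda>_. borel)) (fun_upd w n))"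
    and "\<And>n. \<eta> n \<in> space (prob_algebra (PiM {..<n} (\<lambda>_. borel)))"
    and "\<And>n. AE h in joint_law (PiM {..<n} (\<lambda>_. borel)) (\<eta> n) (state_law T x n). \<kappa> n h = \<pi> n h"
proof -
  let ?L = "\<lambda>n. PiM {..<n} (\<lambda>_. borel :: ('x \<times> 'u) measure)"
  let ?ok = "\<lambda>n (\<eta>, \<kappa>). \<eta> \<in> space (prob_algebra (?L n)) \<and>
      \<kappa> \<in> hist_space n \<rightarrow>\<^sub>M prob_algebra borel \<and>
      (AE h in joint_law (?L n) \<eta> (state_law T x n). \<kappa> h = \<pi> n h) \<and>
      (n = 0 \<longrightarrow> \<eta> = return (?L 0) (\<lambda>_. undefined))"
  let ?next = "\<lambda>n (\<eta>, \<kappa>) (\<eta>', \<kappa>' :: ('x, 'u) hist \<Rightarrow> 'u measure).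
      \<eta>' = \<eta> \<bind> (\<lambda>w. distr (step_law T x \<kappa> n w) (?L (Suc n)) (fun_upd w n))"
  have version: "\<exists>\<kappa>. \<kappa> \<in> hist_space n \<rightarrow>\<^sub>M prob_algebra borel \<and>
      (AE h in joint_law (?L n) \<eta> (state_law T x n). \<kappa> h = \<pi> n h)"
    if \<eta>: "\<eta> \<in> space (prob_algebra (?L n))" for n \<eta>
  proof -
    have "joint_law (?L n) \<eta> (state_law T x n) \<in> space (prob_algebra (hist_space n))"
      using joint_law_prob[OF \<eta> measurable_state_law[OF T]]
      by (simp add: space_prob_algebra hist_space_def)
    then obtain \<kappa> where "\<kappa> \<in> hist_space n \<rightarrow>\<^sub>M prob_algebra borel"
      "AE h in joint_law (?L n) \<eta> (state_law T x n). \<kappa> h = \<pi> n h"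
      by (rule universal_kernel_version[OF \<pi>])
    then show ?thesis by blast
  qed
  have start: "return (?L 0) (\<lambda>_. undefined) \<in> space (prob_algebra (?L 0))"
    unfolding space_prob_algebra by (auto simp: space_PiM intro!: prob_space_return)
  have "\<exists>F. \<forall>n. ?ok n (F n) \<and> ?next n (F n) (F (Suc n))"
  proof (rule dependent_nat_choice[of ?ok ?next])
    obtain \<kappa> where "\<kappa> \<in> hist_space 0 \<rightarrow>\<^sub>M prob_algebra borel"
      "AE h in joint_law (?L 0) (return (?L 0) (\<lambda>_. undefined)) (state_law T x 0). \<kappa> h = \<pi> 0 h"
      using version[OF start] by blast
    then have "?ok 0 (return (?L 0) (\<lambda>_. undefined), \<kappa>)"
      using start unfolding prod.case by blast
    then show "\<exists>p. ?ok 0 p" ..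
  next
    fix p n assume p: "?ok n p"
    obtain \<eta> \<kappa> where "p = (\<eta>, \<kappa>)" by fastforce
    have \<eta>: "\<eta> \<in> space (prob_algebra (?L n))" and \<kappa>: "\<kappa> \<in> hist_space n \<rightarrow>\<^sub>M prob_algebra borel"
      using p unfolding \<open>p = (\<eta>, \<kappa>)\<close> prod.case by blast+
    let ?\<eta>' = "\<eta> \<bind> (\<lambda>w. distr (step_law T x \<kappa> n w) (?L (Suc n)) (fun_upd w n))"
    have [measurable]: "step_law T x \<kappa> n \<in> ?L n \<rightarrow>\<^sub>M prob_algebra borel"
      by (rule measurable_step_law[OF T \<kappa>])
    have [measurable]: "(\<lambda>(w, z). fun_upd w n z) \<in> ?L n \<Otimes>\<^sub>M borel \<rightarrow>\<^sub>M ?L (Suc n)"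
      unfolding lessThan_Suc by (rule measurable_add_dim)
    have "(\<lambda>w. distr (step_law T x \<kappa> n w) (?L (Suc n)) (fun_upd w n)) \<in> ?L n \<rightarrow>\<^sub>M prob_algebra (?L (Suc n))"
      by (rule measurable_distr_prob_space2) measurable
    from prob_space_bind'[OF \<eta> this] sets_bind'[OF \<eta> this]
    have "?\<eta>' \<in> space (prob_algebra (?L (Suc n)))" by (simp add: space_prob_algebra)
    moreover from version[OF this] obtain \<kappa>' where
      "\<kappa>' \<in> hist_space (Suc n) \<rightarrow>\<^sub>M prob_algebra borel"
      "AE h in joint_law (?L (Suc n)) ?\<eta>' (state_law T x (Suc n)). \<kappa>' h = \<pi> (Suc n) h"
      by blast
    ultimately have "?ok (Suc n) (?\<eta>', \<kappa>') \<and> ?next n p (?\<eta>', \<kappa>')"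
      unfolding \<open>p = (\<eta>, \<kappa>)\<close> prod.case by blast
    then show "\<exists>q. ?ok (Suc n) q \<and> ?next n p q" ..
  qed
  then obtain F where F: "\<forall>n. ?ok n (F n) \<and> ?next n (F n) (F (Suc n))" ..
  have ok: "?ok n (F n)" and nxt: "?next n (F n) (F (Suc n))" for n
    using spec[OF F, of n] by (rule conjunct1, rule conjunct2)
  show thesis
  proof (rule that[of "\<lambda>n. snd (F n)" "\<lambda>n. fst (F n)"])
    show "fst (F 0) = return (?L 0) (\<lambda>_. undefined)" using ok[of 0] unfolding split_beta by blast
    fix n
    show "snd (F n) \<in> hist_space n \<rightarrow>\<^sub>M prob_algebra borel"
      "fst (F n) \<in> space (prob_algebra (?L n))"
      "AE h in joint_law (?L n) (fst (F n)) (state_law T x n). snd (F n) h = \<pi> n h"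
      using ok[of n] unfolding split_beta by blast+
    show "fst (F (Suc n)) = fst (F n) \<bind>
        (\<lambda>w. distr (step_law T x (snd (F n)) n w) (?L (Suc n)) (fun_upd w n))"
      using nxt[of n] unfolding split_beta .
  qed
qed

text \<open>The theorem of Ionescu Tulcea, applied to the Borel versions, yields a measure whose prefix laws
  are the \<open>\<eta> n\<close> for which these versions were chosen. So under this measure the versions agree almost
  surely with the original kernels along the path, and the conditional laws are the prescribed ones.\<close>

lemma path_measure_exists:
  fixes T :: "'x :: second_countable_topology \<times> 'u :: second_countable_topology \<Rightarrow> 'x measure"
  assumes T: "T \<in> borel \<rightarrow>\<^sub>M prob_algebra borel"
    and \<pi>: "\<And>n. universal_kernel (hist_space n) borel (\<pi> n)"
    and x: "closed {x}"
  shows "\<exists>P. is_path_measure T \<pi> x P"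
proof -
  let ?L = "\<lambda>n. PiM {..<n} (\<lambda>_. borel :: ('x \<times> 'u) measure)"
  obtain \<eta> \<kappa> where \<kappa>: "\<And>n. \<kappa> n \<in> hist_space n \<rightarrow>\<^sub>M prob_algebra borel"
    and \<eta>0: "\<eta> 0 = return (?L 0) (\<lambda>_. undefined)"
    and \<eta>Suc: "\<And>n. \<eta> (Suc n) =
      \<eta> n \<bind> (\<lambda>w. distr (step_law T x (\<kappa> n) n w) (?L (Suc n)) (fun_upd w n))"
    and \<eta>: "\<And>n. \<eta> n \<in> space (prob_algebra (?L n))"
    and version: "\<And>n. AE h in joint_law (?L n) (\<eta> n) (state_law T x n). \<kappa> n h = \<pi> n h"
  proof (rule exists_versions_along_prefix_laws[OF T \<pi>, where x=x], goal_cases)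
    case (1 \<eta> \<kappa>)
    show ?thesis by (rule that[of \<kappa> \<eta>, OF 1(2-6)])
  qed
  have step: "step_law T x (\<kappa> n) n \<in> ?L n \<rightarrow>\<^sub>M prob_algebra borel" for n
    by (rule measurable_step_law[OF T \<kappa>])
  interpret IT: Ionescu_Tulcea "\<lambda>n. step_law T x (\<kappa> n) n" "\<lambda>_. borel"
  proof (rule Ionescu_Tulcea.intro)
    fix n
    show "step_law T x (\<kappa> n) n \<in> PiM {0..<n} (\<lambda>_. borel) \<rightarrow>\<^sub>M subprob_algebra borel"
      using measurable_prob_algebraD[OF step] by (simp add: atLeast0LessThan)
    fix w :: "nat \<Rightarrow> 'x \<times> 'u"
    assume "w \<in> space (PiM {0..<n} (\<lambda>_. borel))"
    then show "prob_space (step_law T x (\<kappa> n) n w)"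
      using measurable_space[OF step, of w n] by (simp add: space_prob_algebra atLeast0LessThan)
  qed
  have C: "IT.C 0 n (\<lambda>_. undefined) = \<eta> n" for n
  proof (induction n)
    case 0 then show ?case by (simp add: \<eta>0)
  next
    case (Suc n) then show ?case
      by (simp add: \<eta>Suc IT.eP_def[abs_def] atLeast0LessThan)
  qed
  define P where "P = IT.PF.lim"
  have sP[measurable_cong]: "sets P = sets path_space"
    unfolding P_def path_space_def by (rule IT.PF.sets_lim)
  have prefix: "distr P (?L n) (\<lambda>\<omega>. restrict \<omega> {..<n}) = \<eta> n" for n
  proof -
    have "IT.up_to {0..<n} = n"
      using IT.up_to_iff_Ico[of "{0..<n}" n] IT.up_to[of "{0..<n}"]
      by (intro antisym) (auto simp: ivl_subset)
    then show ?thesis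
      using IT.distr_lim[of "{0..<n}"] IT.distr_C[of n n "\<lambda>_. undefined" 0]
      by (simp add: IT.CI_def P_def C atLeast0LessThan)
  qed
  have restrict_P: "(\<lambda>\<omega>. restrict \<omega> {..<n}) \<in> P \<rightarrow>\<^sub>M ?L n" for n
    by (intro measurable_restrict) measurable
  have pP: "prob_space P"
  proof (rule prob_space_distrD[OF restrict_P])
    show "prob_space (distr P (?L 0) (\<lambda>\<omega>. restrict \<omega> {..<0}))"
      using \<eta>[of 0] unfolding prefix by (simp add: space_prob_algebra)
  qed
  have hist_action: "(\<integral>\<^sup>+\<omega>. f (hist n \<omega>, snd (\<omega> n)) \<partial>P) =
      (\<integral>\<^sup>+w. (\<integral>\<^sup>+y. (\<integral>\<^sup>+u. f ((w, y), u) \<partial>\<kappa> n (w, y)) \<partial>state_law T x n w) \<partial>\<eta> n)"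
    if f: "f \<in> borel_measurable (hist_space n \<Otimes>\<^sub>M borel)" for f n
  proof -
    let ?split = "\<lambda>w. ((restrict w {..<n}, fst (w n)), snd (w n) :: 'u)"
    have split: "?split \<in> ?L (Suc n) \<rightarrow>\<^sub>M hist_space n \<Otimes>\<^sub>M borel"
      unfolding hist_space_def
      by (intro measurable_Pair measurable_restrict
          measurable_compose[OF measurable_component_singleton[of n "{..<Suc n}"]]
          measurable_component_singleton borel_measurable_continuous_onI continuous_intros) auto
    let ?f = "\<lambda>w. f (?split w)"
    have f': "?f \<in> borel_measurable (?L (Suc n))"
      by (rule measurable_compose[OF split f])
    have s\<eta>: "sets (\<eta> n) = sets (?L n)" using \<eta> by (simp add: space_prob_algebra)
    have upd: "fun_upd w n \<in> borel \<rightarrow>\<^sub>M ?L (Suc n)" if "w \<in> space (?L n)" for w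
      using that by (intro measurable_fun_upd[where J="{..<n}"]) auto
    have "(\<integral>\<^sup>+\<omega>. f (hist n \<omega>, snd (\<omega> n)) \<partial>P) = (\<integral>\<^sup>+\<omega>. ?f (restrict \<omega> {..<Suc n}) \<partial>P)"
      by (simp add: hist_def Int_absorb1)
    also have "\<dots> = (\<integral>\<^sup>+w. ?f w \<partial>\<eta> (Suc n))"
      unfolding prefix[symmetric]
      using f' by (intro nn_integral_distr[symmetric, OF restrict_P]) simp
    also have "\<dots> = (\<integral>\<^sup>+w. (\<integral>\<^sup>+w'. ?f w' \<partial>distr (step_law T x (\<kappa> n) n w) (?L (Suc n)) (fun_upd w n)) \<partial>\<eta> n)"
      unfolding \<eta>Suc
    proof (rule nn_integral_bind[OF f'])
      have "(\<lambda>w. distr (step_law T x (\<kappa> n) n w) (?L (Suc n)) (fun_upd w n))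
          \<in> ?L n \<rightarrow>\<^sub>M subprob_algebra (?L (Suc n))"
        using IT.measurable_eP[of n] by (simp add: IT.eP_def[abs_def] atLeast0LessThan)
      then show "(\<lambda>w. distr (step_law T x (\<kappa> n) n w) (?L (Suc n)) (fun_upd w n))
          \<in> \<eta> n \<rightarrow>\<^sub>M subprob_algebra (?L (Suc n))"
        by (simp cong: measurable_cong_sets add: s\<eta>)
    qed
    also have "\<dots> = (\<integral>\<^sup>+w. (\<integral>\<^sup>+y. (\<integral>\<^sup>+u. f ((w, y), u) \<partial>\<kappa> n (w, y)) \<partial>state_law T x n w) \<partial>\<eta> n)"
    proof (rule nn_integral_cong)
      fix w assume "w \<in> space (\<eta> n)"
      then have w: "w \<in> space (?L n)" using sets_eq_imp_space_eq[OF s\<eta>] by simp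
      have ss: "sets (step_law T x (\<kappa> n) n w) = sets borel"
        using measurable_space[OF step w] by (simp add: space_prob_algebra)
      have w_n: "restrict (w(n := z)) {..<n} = w" for z
        using w by (auto simp: space_PiM PiE_iff extensional_def restrict_def fun_eq_iff)
      have pair: "(\<lambda>z. f ((w, fst z), snd z)) \<in> borel_measurable borel"
        using measurable_compose[OF upd[OF w] f'] by (simp add: w_n)
      have "(\<integral>\<^sup>+w'. ?f w' \<partial>distr (step_law T x (\<kappa> n) n w) (?L (Suc n)) (fun_upd w n)) =
          (\<integral>\<^sup>+z. ?f (w(n := z)) \<partial>step_law T x (\<kappa> n) n w)"
        using upd[OF w] ss f' by (intro nn_integral_distr) (auto cong: measurable_cong_sets)
      also have "\<dots> = (\<integral>\<^sup>+z. f ((w, fst z), snd z) \<partial>step_law T x (\<kappa> n) n w)"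
        by (simp add: w_n)
      also have "\<dots> = (\<integral>\<^sup>+y. (\<integral>\<^sup>+u. f ((w, y), u) \<partial>\<kappa> n (w, y)) \<partial>state_law T x n w)"
        by (subst nn_integral_step_law[OF T \<kappa> w pair]) simp
      finally show "(\<integral>\<^sup>+w'. ?f w' \<partial>distr (step_law T x (\<kappa> n) n w) (?L (Suc n)) (fun_upd w n)) =
          (\<integral>\<^sup>+y. (\<integral>\<^sup>+u. f ((w, y), u) \<partial>\<kappa> n (w, y)) \<partial>state_law T x n w)" .
    qed
    finally show ?thesis .
  qed
  have hist_P: "hist n \<in> P \<rightarrow>\<^sub>M hist_space n"
    and action_P: "(\<lambda>\<omega>. snd (\<omega> n)) \<in> P \<rightarrow>\<^sub>M borel"
    and state_P: "(\<lambda>\<omega>. fst (\<omega> n)) \<in> P \<rightarrow>\<^sub>M borel" for n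
    unfolding measurable_cong_sets[OF sP refl]
    by (rule measurable_hist, rule measurable_action, rule measurable_state)
  have \<kappa>_prob: "emeasure (\<kappa> n h) UNIV = 1" "sets (\<kappa> n h) = sets borel"
    if "h \<in> space (hist_space n)" for h n
    using measurable_space[OF \<kappa> that] in_space_prob_algebra[OF measurable_space[OF \<kappa> that]]
    by (auto simp: space_prob_algebra)
  have pair_space: "(w, y) \<in> space (hist_space n)" if "w \<in> space (\<eta> n)" for w n and y :: 'x
    using that \<eta>[of n] by (auto simp: space_prob_algebra hist_space_def space_pair_measure
        dest!: sets_eq_imp_space_eq)
  have hist_law: "(\<integral>\<^sup>+\<omega>. f (hist n \<omega>) \<partial>P) =
      (\<integral>\<^sup>+w. (\<integral>\<^sup>+y. f (w, y) \<partial>state_law T x n w) \<partial>\<eta> n)"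
    if f: "f \<in> borel_measurable (hist_space n)" for f n
  proof -
    \<comment> \<open>The action is integrated out: its conditional law has total mass one.\<close>
    have "(\<integral>\<^sup>+\<omega>. f (hist n \<omega>) \<partial>P) =
        (\<integral>\<^sup>+w. (\<integral>\<^sup>+y. (\<integral>\<^sup>+u. f (w, y) \<partial>\<kappa> n (w, y)) \<partial>state_law T x n w) \<partial>\<eta> n)"
      using hist_action[of "\<lambda>z. f (fst z)" n] f by simp
    also have "\<dots> = (\<integral>\<^sup>+w. (\<integral>\<^sup>+y. f (w, y) \<partial>state_law T x n w) \<partial>\<eta> n)"
      using \<kappa>_prob pair_space
      by (intro nn_integral_cong) (simp add: sets_eq_imp_space_eq[OF \<kappa>_prob(2)])
    finally show ?thesis .
  qed
  have version_P: "AE \<omega> in P. \<kappa> n (hist n \<omega>) = \<pi> n (hist n \<omega>)" for n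
  proof -
    have "distr P (hist_space n) (hist n) = joint_law (?L n) (\<eta> n) (state_law T x n)"
    proof (rule measure_eqI)
      have s: "sets (joint_law (?L n) (\<eta> n) (state_law T x n)) = sets (hist_space n)"
        using joint_law_prob(2)[OF \<eta> measurable_state_law[OF T]] by (simp add: hist_space_def)
      then show "sets (distr P (hist_space n) (hist n)) =
          sets (joint_law (?L n) (\<eta> n) (state_law T x n))" by simp
      fix A assume "A \<in> sets (distr P (hist_space n) (hist n))"
      then have A[measurable]: "A \<in> sets (hist_space n)" by simp
      have "emeasure (distr P (hist_space n) (hist n)) A = (\<integral>\<^sup>+\<omega>. indicator A (hist n \<omega>) \<partial>P)"
        by (subst nn_integral_indicator[symmetric], simp, subst nn_integral_distr) simp_all
      also have "\<dots> = (\<integral>\<^sup>+h. indicator A h \<partial>joint_law (?L n) (\<eta> n) (state_law T x n))"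
        using A by (subst hist_law, simp, subst nn_integral_joint_law[OF \<eta> measurable_state_law[OF T]])
          (simp_all add: hist_space_def)
      finally show "emeasure (distr P (hist_space n) (hist n)) A =
          emeasure (joint_law (?L n) (\<eta> n) (state_law T x n)) A"
        using s by simp
    qed
    with version[of n] have "AE h in distr P (hist_space n) (hist n). \<kappa> n h = \<pi> n h"
      by (simp only:)
    then show ?thesis by (rule AE_distrD[rotated]) measurable
  qed
  have action_law: "has_conditional_law P (\<lambda>\<omega>. snd (\<omega> n)) (hist_space n) (hist n) (\<pi> n)" for n
    unfolding has_conditional_law_def nn_integral_completion
  proof (intro ballI)
    fix A :: "('x, 'u) hist set" and B :: "'u set"
    assume A[measurable]: "A \<in> sets (hist_space n)" and B[measurable]: "B \<in> sets borel"
    note [measurable] = measurable_prob_algebraD[OF \<kappa>]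
    have "emeasure P {\<omega> \<in> space P. hist n \<omega> \<in> A \<and> snd (\<omega> n) \<in> B} =
        (\<integral>\<^sup>+\<omega>. indicator (A \<times> B) (hist n \<omega>, snd (\<omega> n)) \<partial>P)"
      unfolding emeasure_joint_event[OF hist_P action_P A B] by (simp add: indicator_times)
    also have "\<dots> = (\<integral>\<^sup>+w. (\<integral>\<^sup>+y. (\<integral>\<^sup>+u. indicator A (w, y) * indicator B u \<partial>\<kappa> n (w, y)) \<partial>state_law T x n w) \<partial>\<eta> n)"
      by (subst hist_action) (auto simp: indicator_times)
    also have "\<dots> = (\<integral>\<^sup>+w. (\<integral>\<^sup>+y. indicator A (w, y) * emeasure (\<kappa> n (w, y)) B \<partial>state_law T x n w) \<partial>\<eta> n)"
      using \<kappa>_prob(2)[OF pair_space] by (intro nn_integral_cong nn_integral_cmult_indicator) simp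
    also have "\<dots> = (\<integral>\<^sup>+\<omega>. indicator A (hist n \<omega>) * emeasure (\<kappa> n (hist n \<omega>)) B \<partial>P)"
      by (subst hist_law) simp_all
    also have "\<dots> = (\<integral>\<^sup>+\<omega>. indicator A (hist n \<omega>) * emeasure (\<pi> n (hist n \<omega>)) B \<partial>P)"
      using version_P[of n] by (intro nn_integral_cong_AE) (auto elim!: eventually_mono)
    finally show "emeasure P {\<omega> \<in> space P. hist n \<omega> \<in> A \<and> snd (\<omega> n) \<in> B} =
        (\<integral>\<^sup>+\<omega>. indicator A (hist n \<omega>) * emeasure (\<pi> n (hist n \<omega>)) B \<partial>P)" .
  qed
  have next_state_law: "has_conditional_law P (\<lambda>\<omega>. fst (\<omega> (Suc n))) (hist_space n \<Otimes>\<^sub>M borel)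
      (\<lambda>\<omega>. (hist n \<omega>, snd (\<omega> n))) (\<lambda>(h, u). T (snd h, u))" for n
    unfolding has_conditional_law_def nn_integral_completion
  proof (intro ballI)
    let ?split = "\<lambda>w. ((restrict w {..<n}, fst (w n)), snd (w n) :: 'u)"
    have split: "?split \<in> ?L (Suc n) \<rightarrow>\<^sub>M hist_space n \<Otimes>\<^sub>M borel"
      unfolding hist_space_def
      by (intro measurable_Pair measurable_restrict
          measurable_compose[OF measurable_component_singleton[of n "{..<Suc n}"]]
          measurable_component_singleton borel_measurable_continuous_onI continuous_intros) auto
    fix A :: "(('x, 'u) hist \<times> 'u) set" and B :: "'x set"
    assume A[measurable]: "A \<in> sets (hist_space n \<Otimes>\<^sub>M borel)" and B[measurable]: "B \<in> sets borel"
    have [measurable]: "(\<lambda>w. indicator A (?split w) :: ennreal) \<in> borel_measurable (?L (Suc n))"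
      using A by (intro measurable_compose[OF split]) simp
    have [measurable]: "(\<lambda>w. emeasure (T (w n)) B) \<in> borel_measurable (?L (Suc n))"
      by (intro measurable_compose[OF measurable_compose[OF _ measurable_prob_algebraD[OF T]]
            measurable_emeasure_subprob_algebra] measurable_component_singleton) auto
    have "emeasure P {\<omega> \<in> space P. (hist n \<omega>, snd (\<omega> n)) \<in> A \<and> fst (\<omega> (Suc n)) \<in> B} =
        (\<integral>\<^sup>+\<omega>. indicator A (?split (fst (hist (Suc n) \<omega>))) * indicator B (snd (hist (Suc n) \<omega>)) \<partial>P)"
      unfolding emeasure_joint_event[OF measurable_Pair[OF hist_P action_P] state_P A B]
      by (simp add: hist_def Int_absorb1)
    also have "\<dots> = (\<integral>\<^sup>+w. (\<integral>\<^sup>+y. indicator A (?split w) * indicator B y \<partial>T (w n)) \<partial>\<eta> (Suc n))"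
      by (subst hist_law) (simp_all add: hist_space_def state_law_def)
    also have "\<dots> = (\<integral>\<^sup>+w. indicator A (?split w) * emeasure (T (w n)) B \<partial>\<eta> (Suc n))"
      using measurable_space[OF T]
      by (intro nn_integral_cong nn_integral_cmult_indicator) (simp add: space_prob_algebra)
    also have "\<dots> = (\<integral>\<^sup>+\<omega>. indicator A (?split (restrict \<omega> {..<Suc n})) *
        emeasure (T (restrict \<omega> {..<Suc n} n)) B \<partial>P)"
      unfolding prefix[symmetric]
      by (intro nn_integral_distr[OF restrict_P]) simp
    finally show "emeasure P {\<omega> \<in> space P. (hist n \<omega>, snd (\<omega> n)) \<in> A \<and> fst (\<omega> (Suc n)) \<in> B} =
        (\<integral>\<^sup>+\<omega>. indicator A (hist n \<omega>, snd (\<omega> n)) *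
          emeasure (case (hist n \<omega>, snd (\<omega> n)) of (h, u) \<Rightarrow> T (snd h, u)) B \<partial>P)"
      by (simp add: hist_def Int_absorb1)
  qed
  have "AE \<omega> in P. fst (\<omega> 0) = x"
  proof -
    have [measurable]: "{x} \<in> sets borel" using x by (rule borel_closed)
    have "(\<integral>\<^sup>+\<omega>. indicator (- {x}) (snd (hist 0 \<omega>)) \<partial>P) =
        (\<integral>\<^sup>+w. (\<integral>\<^sup>+y. indicator (- {x}) y \<partial>return borel x) \<partial>\<eta> 0)"
      by (subst hist_law) (simp_all add: state_law_def)
    also have "\<dots> = 0" by (simp add: nn_integral_return)
    finally have "AE \<omega> in P. indicator (- {x}) (snd (hist 0 \<omega>)) = (0 :: ennreal)"
      by (subst (asm) nn_integral_0_iff_AE) simp_all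
    then show ?thesis by eventually_elim (auto simp: hist_def split: split_indicator_asm)
  qed
  then have "is_path_measure T \<pi> x P"
    using pP sP action_law next_state_law by (auto simp: is_path_measure_def)
  then show ?thesis ..
qed

section \<open>One step of the controlled process\<close>

text \<open>The path measure is a definite description, which has a meaning only if existence and uniqueness
  are both known. They have to be known for history-dependent policies as well, since the viable core
  is defined by a supremum over all policies.\<close>

lemma is_path_measure_path_measure:
  assumes "cdt_MP K T" "\<pi> \<in> policies K"
  shows "is_path_measure T \<pi> x (path_measure T \<pi> x)"
proof -
  have T: "T \<in> borel \<rightarrow>\<^sub>M prob_algebra borel" and x: "closed {x}"
    using assms(1) Borel_topspace_closed_singleton unfolding cdt_MP_def by auto
  have "\<exists>P. is_path_measure T \<pi> x P"
    using assms(2) by (intro path_measure_exists[OF T _ x]) (auto simp: policies_def)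
  then show ?thesis
    unfolding path_measure_def using path_measure_unique[OF T assms(2)] by (metis theI)
qed

text \<open>The Markov property in integrated form: conditioning on the history and the action integrates
  \<open>f\<close> against the transition kernel, conditioning on the history alone then averages over the action.\<close>

lemma nn_integral_next_state:
  fixes T :: "'x :: second_countable_topology \<times> 'u :: second_countable_topology \<Rightarrow> 'x measure"
    and f :: "'x \<Rightarrow> ennreal"
  assumes T: "T \<in> borel \<rightarrow>\<^sub>M prob_algebra borel"
    and \<pi>: "universal_kernel (hist_space n) borel (\<pi> n)"
    and P: "is_path_measure T \<pi> x P"
    and A[measurable]: "A \<in> sets (hist_space n)" and f[measurable]: "f \<in> borel_measurable borel"
  shows "(\<integral>\<^sup>+\<omega>. indicator A (hist n \<omega>) * f (fst (\<omega> (Suc n))) \<partial>P) =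
    (\<integral>\<^sup>+\<omega>. indicator A (hist n \<omega>) *
      (\<integral>\<^sup>+u. (\<integral>\<^sup>+y. f y \<partial>T (fst (\<omega> n), u)) \<partial>\<pi> n (hist n \<omega>)) \<partial>P)"
proof -
  have pP: "prob_space P" and sP: "sets P = sets path_space"
    and action: "has_conditional_law P (\<lambda>\<omega>. snd (\<omega> n)) (hist_space n) (hist n) (\<pi> n)"
    and next_state: "has_conditional_law P (\<lambda>\<omega>. fst (\<omega> (Suc n))) (hist_space n \<Otimes>\<^sub>M borel)
        (\<lambda>\<omega>. (hist n \<omega>, snd (\<omega> n))) (\<lambda>(h, u). T (snd h, u))"
    using P unfolding is_path_measure_def by auto
  have hist_P: "hist n \<in> P \<rightarrow>\<^sub>M hist_space n"
    and action_P: "(\<lambda>\<omega>. snd (\<omega> n)) \<in> P \<rightarrow>\<^sub>M borel"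
    and state_P: "(\<lambda>\<omega>. fst (\<omega> n)) \<in> P \<rightarrow>\<^sub>M borel" for n
    unfolding measurable_cong_sets[OF sP refl]
    by (rule measurable_hist, rule measurable_action, rule measurable_state)
  define F where "F z = (\<integral>\<^sup>+y. f y \<partial>T z)" for z
  have F[measurable]: "F \<in> borel_measurable borel"
    unfolding F_def
    by (rule measurable_compose[OF measurable_prob_algebraD[OF T] nn_integral_measurable_subprob_algebra[OF f]])
  have "(\<lambda>(h, u). F (snd h, u)) \<in> borel_measurable (hist_space n \<Otimes>\<^sub>M borel)"
    unfolding split_beta by (rule measurable_compose[OF _ F]) measurable
  then have FA[measurable]: "(\<lambda>z. indicator A (fst z) * F (snd (fst z), snd z)) \<in> borel_measurable (hist_space n \<Otimes>\<^sub>M borel)"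
    unfolding split_beta by measurable
  have "(\<integral>\<^sup>+\<omega>. indicator A (hist n \<omega>) * f (fst (\<omega> (Suc n))) \<partial>P) =
      (\<integral>\<^sup>+\<omega>. (\<integral>\<^sup>+y. indicator A (hist n \<omega>) * f y \<partial>T (snd (hist n \<omega>), snd (\<omega> n))) \<partial>P)"
    using nn_integral_conditional_law[OF pP measurable_Pair[OF hist_P action_P] state_P next_state
        universal_kernel_of_measurable[OF measurable_transition[OF T]],
        of "\<lambda>z. indicator A (fst (fst z)) * f (snd z)"]
    by simp
  also have "\<dots> = (\<integral>\<^sup>+\<omega>. indicator A (hist n \<omega>) * F (snd (hist n \<omega>), snd (\<omega> n)) \<partial>P)"
    using measurable_space[OF T] unfolding F_def
    by (intro nn_integral_cong nn_integral_cmult) (simp add: space_prob_algebra cong: measurable_cong_sets)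
  also have "\<dots> = (\<integral>\<^sup>+\<omega>. (\<integral>\<^sup>+u. indicator A (hist n \<omega>) * F (snd (hist n \<omega>), u) \<partial>\<pi> n (hist n \<omega>)) \<partial>P)"
    using nn_integral_conditional_law[OF pP hist_P action_P action \<pi> FA] by simp
  also have "\<dots> = (\<integral>\<^sup>+\<omega>. indicator A (hist n \<omega>) * (\<integral>\<^sup>+u. F (snd (hist n \<omega>), u) \<partial>\<pi> n (hist n \<omega>)) \<partial>P)"
  proof (intro nn_integral_cong nn_integral_cmult)
    fix \<omega>
    assume "\<omega> \<in> space P"
    then have "hist n \<omega> \<in> space (hist_space n)" using hist_P by (rule measurable_space[rotated])
    then have [measurable_cong]: "sets (\<pi> n (hist n \<omega>)) = sets borel"
      by (rule universal_kernel_prob[OF \<pi>])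
    show "(\<lambda>u. F (snd (hist n \<omega>), u)) \<in> borel_measurable (\<pi> n (hist n \<omega>))" by measurable
  qed
  finally show ?thesis by (simp add: F_def hist_def)
qed

section \<open>Excessive functions bound hitting probabilities\<close>

text \<open>A maximal inequality. Stopped when it first exceeds one, the process \<open>g (x\<^sub>n)\<close> is a nonnegative
  supermartingale, because excessivity holds as long as \<open>g (x\<^sub>n) \<le> 1\<close>. Let \<open>D n\<close> be the event that
  the level one has not been exceeded before time \<open>n\<close>. The quantity \<open>p n\<close> below is the expectation of
  \<open>g (x\<^sub>n)\<close> on \<open>D n\<close> and of the constant one off \<open>D n\<close>. It starts at \<open>g x\<close>, does not increase, and dominates
  the probability of the complement of \<open>D n\<close>.\<close>

lemma prob_exceeding_one_le:
  fixes T :: "'x :: second_countable_topology \<times> 'u :: second_countable_topology \<Rightarrow> 'x measure"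
    and g :: "'x \<Rightarrow> ennreal"
  assumes T: "T \<in> borel \<rightarrow>\<^sub>M prob_algebra borel"
    and \<pi>: "\<And>n. universal_kernel (hist_space n) borel (\<pi> n)"
    and P: "is_path_measure T \<pi> x P"
    and g[measurable]: "g \<in> borel_measurable borel"
    and excessive: "\<And>n \<omega>. g (fst (\<omega> n)) \<le> 1 \<Longrightarrow>
      (\<integral>\<^sup>+u. (\<integral>\<^sup>+y. g y \<partial>T (fst (\<omega> n), u)) \<partial>\<pi> n (hist n \<omega>)) \<le> g (fst (\<omega> n))"
  shows "emeasure P {\<omega>. \<exists>i. 1 < g (fst (\<omega> i))} \<le> g x"
proof -
  have pP: "prob_space P" and sP[measurable_cong]: "sets P = sets path_space"
    and x0: "AE \<omega> in P. fst (\<omega> 0) = x"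
    using P unfolding is_path_measure_def by auto
  have spP: "space P = UNIV" using sets_eq_imp_space_eq[OF sP] by simp
  have gx[measurable]: "(\<lambda>\<omega>. g (fst (\<omega> n))) \<in> borel_measurable P" for n
    unfolding measurable_cong_sets[OF sP refl] by (rule measurable_compose[OF measurable_state g])
  define D :: "nat \<Rightarrow> ('x, 'u) path set" where "D n = {\<omega>. \<forall>k<n. g (fst (\<omega> k)) \<le> 1}" for n
  have D_sets[measurable]: "D n \<in> sets P" for n
  proof -
    have "D n = {\<omega> \<in> space P. \<forall>k\<in>{..<n}. g (fst (\<omega> k)) \<le> 1}" by (auto simp: D_def spP)
    also have "\<dots> \<in> sets P" by measurable
    finally show ?thesis .
  qed
  define p where "p n = (\<integral>\<^sup>+\<omega>. indicator (- D n) \<omega> + indicator (D n) \<omega> * g (fst (\<omega> n)) \<partial>P)" for n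
  have p_step: "p (Suc n) \<le> p n" for n
  proof -
    define A :: "('x, 'u) hist set" where
      "A = {h \<in> space (hist_space n). (\<forall>k\<in>{..<n}. g (fst (fst h k)) \<le> 1) \<and> g (snd h) \<le> 1}"
    have "(\<lambda>h. g (fst (fst h k))) \<in> borel_measurable (hist_space n)" if "k < n" for k
      unfolding hist_space_def using that
      by (intro measurable_compose[OF _ g] measurable_compose[OF measurable_compose[OF measurable_fst
              measurable_component_singleton]] borel_measurable_continuous_onI continuous_intros) auto
    moreover have "(\<lambda>h. g (snd h)) \<in> borel_measurable (hist_space n)"
      by measurable
    ultimately have A: "A \<in> sets (hist_space n)"
      unfolding A_def by (intro sets.sets_Collect_conj sets.sets_Collect_finite_All borel_measurable_le) auto
    have A_D: "indicator A (hist n \<omega>) = (indicator (D (Suc n)) \<omega> :: ennreal)" for \<omega>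
      using measurable_space[OF measurable_hist, of \<omega> n]
      by (auto simp: A_def D_def hist_def less_Suc_eq split: split_indicator)
    have "p (Suc n) = (\<integral>\<^sup>+\<omega>. indicator (- D (Suc n)) \<omega> \<partial>P) +
        (\<integral>\<^sup>+\<omega>. indicator (D (Suc n)) \<omega> * g (fst (\<omega> (Suc n))) \<partial>P)"
      unfolding p_def using D_sets[of "Suc n"] sets.compl_sets[OF D_sets[of "Suc n"]]
      by (intro nn_integral_add) (simp_all add: spP Compl_eq_Diff_UNIV)
    also have "(\<integral>\<^sup>+\<omega>. indicator (D (Suc n)) \<omega> * g (fst (\<omega> (Suc n))) \<partial>P) =
        (\<integral>\<^sup>+\<omega>. indicator (D (Suc n)) \<omega> *
          (\<integral>\<^sup>+u. (\<integral>\<^sup>+y. g y \<partial>T (fst (\<omega> n), u)) \<partial>\<pi> n (hist n \<omega>)) \<partial>P)"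
      using nn_integral_next_state[OF T \<pi> P A g] unfolding A_D .
    also have "\<dots> \<le> (\<integral>\<^sup>+\<omega>. indicator (D (Suc n)) \<omega> * g (fst (\<omega> n)) \<partial>P)"
      using excessive by (intro nn_integral_mono) (auto simp: D_def split: split_indicator)
    also have "(\<integral>\<^sup>+\<omega>. indicator (- D (Suc n)) \<omega> \<partial>P) + \<dots> =
        (\<integral>\<^sup>+\<omega>. indicator (- D (Suc n)) \<omega> + indicator (D (Suc n)) \<omega> * g (fst (\<omega> n)) \<partial>P)"
      using D_sets[of "Suc n"] sets.compl_sets[OF D_sets[of "Suc n"]]
      by (intro nn_integral_add[symmetric]) (simp_all add: spP Compl_eq_Diff_UNIV)
    \<comment> \<open>Off \<open>D (Suc n)\<close> but in \<open>D n\<close> the integrand drops from \<open>g (x\<^sub>n) > 1\<close> to one.\<close>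
    also have "\<dots> \<le> p n"
      unfolding p_def
      by (intro nn_integral_mono) (auto simp: D_def less_Suc_eq not_le split: split_indicator intro: less_imp_le)
    finally show ?thesis by (simp add: add_left_mono)
  qed
  have "p 0 = (\<integral>\<^sup>+\<omega>. g x \<partial>P)"
    unfolding p_def using x0 by (intro nn_integral_cong_AE) (auto simp: D_def elim!: eventually_mono)
  also have "\<dots> = g x" using prob_space.emeasure_space_1[OF pP] by simp
  finally have p0: "p 0 = g x" .
  have p_le: "p n \<le> g x" for n
    by (induction n) (use p0 p_step order_trans in auto)
  have exit: "emeasure P (- D n) \<le> g x" for n
  proof -
    have "emeasure P (- D n) = (\<integral>\<^sup>+\<omega>. indicator (- D n) \<omega> \<partial>P)"
      using sets.compl_sets[OF D_sets[of n]] by (simp add: spP Compl_eq_Diff_UNIV)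
    also have "\<dots> \<le> p n" unfolding p_def by (intro nn_integral_mono) (auto split: split_indicator)
    also have "\<dots> \<le> g x" by (rule p_le)
    finally show ?thesis .
  qed
  have "{\<omega>. \<exists>i. 1 < g (fst (\<omega> i))} = (\<Union>n. - D n)"
    unfolding D_def by (auto simp: not_le) (metis lessI)
  also have "emeasure P \<dots> = (SUP n. emeasure P (- D n))"
    using sets.compl_sets[OF D_sets]
    by (intro SUP_emeasure_incseq[symmetric] monoI) (auto simp: spP Compl_eq_Diff_UNIV D_def)
  also have "\<dots> \<le> g x" using exit by (intro SUP_least)
  finally show ?thesis .
qed

lemma closed_section:
  assumes "closed K"
  shows "closed (K `` {x})"
proof -
  have "closed ((\<lambda>u. (x, u)) -` K)"
    using assms by (intro closed_vimage continuous_intros)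
  also have "(\<lambda>u. (x, u)) -` K = K `` {x}" by auto
  finally show ?thesis .
qed

lemma nn_integral_bounded_eq_integral:
  assumes "prob_space M" "f \<in> borel_measurable M" "\<And>y. 0 \<le> f y" "\<And>y. f y \<le> C"
  shows "(\<integral>\<^sup>+y. ennreal (f y) \<partial>M) = ennreal (\<integral>y. f y \<partial>M)" "(\<integral>y. f y \<partial>M) \<le> C"
proof -
  interpret prob_space M by fact
  have int: "integrable M f" using assms by (intro integrable_const_bound[of _ C]) auto
  then show "(\<integral>\<^sup>+y. ennreal (f y) \<partial>M) = ennreal (\<integral>y. f y \<partial>M)"
    using assms(3) by (intro nn_integral_eq_integral) auto
  have "(\<integral>y. f y \<partial>M) \<le> (\<integral>y. C \<partial>M)" using int assms(4) by (intro integral_mono) auto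
  then show "(\<integral>y. f y \<partial>M) \<le> C" by (simp add: prob_space)
qed

text \<open>Excessivity is a statement about Bochner integrals, while the maximal inequality uses nonnegative
  integrals. They agree because \<open>g\<close> is bounded. The policy charges only admissible actions, so the
  pointwise bound over admissible actions survives averaging.\<close>

lemma locally_uniformly_excessive_nn_integral:
  fixes T :: "'x :: second_countable_topology \<times> 'u :: second_countable_topology \<Rightarrow> 'x measure"
  assumes T: "T \<in> borel \<rightarrow>\<^sub>M prob_algebra borel" and K: "closed K"
    and g: "locally_uniformly_excessive K T g"
    and \<nu>: "prob_space \<nu>" "sets \<nu> = sets borel" "emeasure (completion \<nu>) (K `` {x}) = 1"
    and x: "g x \<le> 1"
  shows "(\<integral>\<^sup>+u. (\<integral>\<^sup>+y. ennreal (g y) \<partial>T (x, u)) \<partial>\<nu>) \<le> ennreal (g x)"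
proof -
  interpret prob_space \<nu> by fact
  obtain C where C: "\<And>y. g y \<le> C"
    using g unfolding locally_uniformly_excessive_def bounded_nonneg_borel_def bounded_iff
    by (metis abs_le_D1 rangeI real_norm_def)
  have g_meas: "g \<in> borel_measurable borel" and nonneg: "\<And>y. 0 \<le> g y"
    using g by (auto simp: locally_uniformly_excessive_def bounded_nonneg_borel_def)
  have Kx: "K `` {x} \<in> sets \<nu>" using closed_section[OF K] \<nu>(2) by (simp add: borel_closed)
  then have "AE u in \<nu>. u \<in> K `` {x}"
    using \<nu>(3) by (intro AE_prob_1) (simp add: measure_def)
  then have "(\<integral>\<^sup>+u. (\<integral>\<^sup>+y. ennreal (g y) \<partial>T (x, u)) \<partial>\<nu>) \<le> (\<integral>\<^sup>+u. ennreal (g x) \<partial>\<nu>)"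
  proof (intro nn_integral_mono_AE, eventually_elim)
    fix u assume "u \<in> K `` {x}"
    then have "(\<integral>y. g y \<partial>T (x, u)) \<le> g x"
      using g x by (auto simp: locally_uniformly_excessive_def)
    moreover have "prob_space (T (x, u))" "sets (T (x, u)) = sets borel"
      using measurable_space[OF T, of "(x, u)"] by (auto simp: space_prob_algebra)
    ultimately show "(\<integral>\<^sup>+y. ennreal (g y) \<partial>T (x, u)) \<le> ennreal (g x)"
      using g_meas by (subst nn_integral_bounded_eq_integral(1)[OF _ _ nonneg C])
        (auto intro: ennreal_leI cong: measurable_cong_sets)
  qed
  then show ?thesis by (simp add: emeasure_space_1)
qed

lemma locally_excessive_nn_integral:
  fixes T :: "'x :: second_countable_topology \<times> 'u :: second_countable_topology \<Rightarrow> 'x measure"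
  assumes T: "T \<in> borel \<rightarrow>\<^sub>M prob_algebra borel" and g: "locally_excessive K T \<mu> g" and x: "g x \<le> 1"
  shows "(\<integral>\<^sup>+u. (\<integral>\<^sup>+y. ennreal (g y) \<partial>T (x, u)) \<partial>\<mu> x) \<le> ennreal (g x)"
proof -
  obtain C where C: "\<And>y. g y \<le> C"
    using g unfolding locally_excessive_def bounded_nonneg_borel_def bounded_iff
    by (metis abs_le_D1 rangeI real_norm_def)
  have g_meas: "g \<in> borel_measurable borel" and nonneg: "\<And>y. 0 \<le> g y"
    using g by (auto simp: locally_excessive_def bounded_nonneg_borel_def)
  have \<mu>: "prob_space (\<mu> x)" "sets (\<mu> x) = sets borel"
    using g universal_kernel_prob[of borel borel \<mu> x]
    by (auto simp: locally_excessive_def randomized_selector_def)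
  have Tx: "prob_space (T (x, u))" "g \<in> borel_measurable (T (x, u))" for u
    using measurable_space[OF T, of "(x, u)"] g_meas
    by (auto simp: space_prob_algebra cong: measurable_cong_sets)
  have "(\<lambda>u. \<integral>y. g y \<partial>T (x, u)) \<in> borel_measurable borel"
    by (rule measurable_compose[OF measurable_compose[OF _ measurable_prob_algebraD[OF T]]
          integral_measurable_subprob_algebra[OF g_meas]]) measurable
  then have inner: "(\<lambda>u. \<integral>y. g y \<partial>T (x, u)) \<in> borel_measurable (\<mu> x)"
    using \<mu>(2) by (simp cong: measurable_cong_sets)
  have "(\<integral>\<^sup>+u. (\<integral>\<^sup>+y. ennreal (g y) \<partial>T (x, u)) \<partial>\<mu> x) = (\<integral>\<^sup>+u. ennreal (\<integral>y. g y \<partial>T (x, u)) \<partial>\<mu> x)"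
    by (intro nn_integral_cong nn_integral_bounded_eq_integral(1)[OF Tx nonneg C])
  also have "\<dots> = ennreal (\<integral>u. (\<integral>y. g y \<partial>T (x, u)) \<partial>\<mu> x)"
    using nn_integral_bounded_eq_integral(2)[OF Tx nonneg C] nonneg
    by (intro nn_integral_bounded_eq_integral(1)[OF \<mu>(1) inner, of C]) simp_all
  also have "\<dots> \<le> ennreal (g x)"
    using g x by (intro ennreal_leI) (auto simp: locally_excessive_def)
  finally show ?thesis .
qed

text \<open>A path can reach \<open>G\<close> only by leaving \<open>S\<close>, hence by leaving \<open>{g \<le> 1}\<close>.\<close>

lemma M_val_until_le:
  fixes T :: "'x :: second_countable_topology \<times> 'u :: second_countable_topology \<Rightarrow> 'x measure"
  assumes D: "cdt_MP K T" and \<pi>: "\<pi> \<in> policies K"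
    and g: "bounded_nonneg_borel g" "localized_on K T S g" and disj: "S \<inter> G = {}"
    and excessive: "\<And>n h. h \<in> space (hist_space n) \<Longrightarrow> g (snd h) \<le> 1 \<Longrightarrow>
      (\<integral>\<^sup>+u. (\<integral>\<^sup>+y. ennreal (g y) \<partial>T (snd h, u)) \<partial>\<pi> n h) \<le> ennreal (g (snd h))"
  shows "M_val T \<pi> x (until_event S G) \<le> ennreal (g x)"
proof -
  let ?P = "path_measure T \<pi> x"
  let ?exit = "{\<omega> :: ('x, 'u) path. \<exists>i. 1 < ennreal (g (fst (\<omega> i)))}"
  have T: "T \<in> borel \<rightarrow>\<^sub>M prob_algebra borel" using D by (simp add: cdt_MP_def)
  have \<pi>n: "universal_kernel (hist_space n) borel (\<pi> n)" for n using \<pi> by (simp add: policies_def)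
  have P: "is_path_measure T \<pi> x ?P" by (rule is_path_measure_path_measure[OF D \<pi>])
  have g_meas: "g \<in> borel_measurable borel" using g(1) by (simp add: bounded_nonneg_borel_def)
  have sP: "sets ?P = sets path_space" using P by (simp add: is_path_measure_def)
  have hit: "1 < ennreal (g y)" if "y \<in> G" for y
    using that g(2) disj by (auto simp: localized_on_def not_le[symmetric])
  have "{\<omega> \<in> space ?P. \<exists>i. 1 < ennreal (g (fst (\<omega> i)))} \<in> sets ?P"
    unfolding sP sets_eq_imp_space_eq[OF sP] using g_meas by measurable
  then have exit_sets: "?exit \<in> sets ?P" by (simp add: sets_eq_imp_space_eq[OF sP])
  have "M_val T \<pi> x (until_event S G) \<le> emeasure ?P ?exit"
    unfolding M_val_def using hit by (intro emeasure_mono exit_sets) (auto simp: until_event_def)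
  also have "\<dots> \<le> ennreal (g x)"
  proof (rule prob_exceeding_one_le[OF T \<pi>n P])
    show "(\<lambda>y. ennreal (g y)) \<in> borel_measurable borel" using g_meas by measurable
    show "(\<integral>\<^sup>+u. (\<integral>\<^sup>+y. ennreal (g y) \<partial>T (fst (\<omega> n), u)) \<partial>\<pi> n (hist n \<omega>)) \<le> ennreal (g (fst (\<omega> n)))"
      if "ennreal (g (fst (\<omega> n))) \<le> 1" for n \<omega>
      using excessive[of "hist n \<omega>" n] measurable_space[OF measurable_hist, of \<omega> n] that
      by (simp add: hist_def)
  qed
  finally show ?thesis .
qed

section \<open>Weakly absorbing sets lie in the viable core\<close>

text \<open>The kernel that witnesses weak absorption is a selector on \<open>B\<close> only. Since \<open>B\<close> is Borel,
  it can be completed outside \<open>B\<close> by the initial kernel of any given policy; the resulting stationary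
  policy keeps the process in \<open>B\<close>, and therefore in \<open>S\<close>, forever with probability one.\<close>

lemma weakly_absorbing_subset_viable_core:
  fixes T :: "'x :: second_countable_topology \<times> 'u :: second_countable_topology \<Rightarrow> 'x measure"
  assumes D: "cdt_MP K T" and \<pi>': "\<pi>' \<in> policies K"
    and B: "weakly_absorbing K T B" "B \<subseteq> S" and S: "S \<in> sets borel"
  shows "B \<subseteq> viable_core K T S"
proof
  fix x assume x: "x \<in> B"
  have T: "T \<in> borel \<rightarrow>\<^sub>M prob_algebra borel" using D by (simp add: cdt_MP_def)
  have B_sets[measurable]: "B \<in> sets borel" using B(1) by (simp add: weakly_absorbing_def)
  obtain \<mu> where \<mu>: "universal_kernel borel borel \<mu>"
    and \<mu>_K: "\<And>x. x \<in> B \<Longrightarrow> emeasure (completion (\<mu> x)) (K `` {x}) = 1"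
    and \<mu>_B: "\<And>x. x \<in> B \<Longrightarrow>
      (\<integral>\<^sup>+u. indicator (K `` {x}) u * emeasure (T (x, u)) B \<partial>completion (\<mu> x)) = 1"
    using B(1) unfolding weakly_absorbing_def by blast
  define \<nu> where "\<nu> y = (if y \<in> B then \<mu> y else initial_kernel \<pi>' y)" for y
  define \<pi> :: "('x, 'u) policy" where "\<pi> n h = \<nu> (snd h)" for n h
  have init: "(\<lambda>_. undefined, y) \<in> space (hist_space 0)" for y :: 'x
    by (simp add: hist_space_def space_pair_measure space_PiM)
  have "(\<lambda>y. (\<lambda>_. undefined, y)) \<in> borel \<rightarrow>\<^sub>M
      (hist_space 0 :: ('x, 'u) hist measure)"
    unfolding hist_space_def by (intro measurable_Pair measurable_const) (simp_all add: space_PiM)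
  from universal_kernel_compose[OF this, of borel "\<pi>' 0"] \<pi>'
  have "universal_kernel borel borel (initial_kernel \<pi>')"
    by (auto simp: initial_kernel_def[abs_def] policies_def)
  then have \<nu>: "universal_kernel borel borel \<nu>"
    unfolding \<nu>_def by (intro universal_kernel_if \<mu>) auto
  have \<nu>_K: "emeasure (completion (\<nu> y)) (K `` {y}) = 1" for y
    using \<mu>_K \<pi>' init[of y] by (fastforce simp: \<nu>_def initial_kernel_def policies_def)
  have "universal_kernel (hist_space n) borel (\<pi> n)" for n
    unfolding \<pi>_def by (rule universal_kernel_compose[OF measurable_current_state \<nu>])
  then have \<pi>: "\<pi> \<in> policies K"
    using \<nu>_K by (simp add: policies_def \<pi>_def)
  \<comment> \<open>Weak absorption bounds the probability of staying in \<open>B\<close> from below; leaving is complementary.\<close>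
  have leave: "(\<integral>\<^sup>+u. emeasure (T (y, u)) (- B) \<partial>\<nu> y) = 0" if y: "y \<in> B" for y
  proof -
    interpret prob_space "\<nu> y" using universal_kernel_prob[OF \<nu>] by simp
    have s\<nu>: "sets (\<nu> y) = sets borel" using universal_kernel_prob[OF \<nu>] by simp
    have meas: "(\<lambda>u. emeasure (T (y, u)) C) \<in> borel_measurable (\<nu> y)" if "C \<in> sets borel" for C
      unfolding measurable_cong_sets[OF s\<nu> refl]
      by (rule measurable_compose[OF measurable_compose[OF _ measurable_prob_algebraD[OF T]]
          measurable_emeasure_subprob_algebra[OF that]]) measurable
    have "1 = (\<integral>\<^sup>+u. indicator (K `` {y}) u * emeasure (T (y, u)) B \<partial>\<nu> y)"
      using \<mu>_B[OF y] y by (simp add: \<nu>_def nn_integral_completion)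
    also have "\<dots> \<le> (\<integral>\<^sup>+u. emeasure (T (y, u)) B \<partial>\<nu> y)"
      by (intro nn_integral_mono) (auto split: split_indicator)
    finally have stay: "1 \<le> (\<integral>\<^sup>+u. emeasure (T (y, u)) B \<partial>\<nu> y)" .
    have total: "emeasure (T (y, u)) B + emeasure (T (y, u)) (- B) = 1" for u
    proof -
      have Ty: "prob_space (T (y, u))" "sets (T (y, u)) = sets borel"
        using measurable_space[OF T, of "(y, u)"] by (auto simp: space_prob_algebra)
      then show ?thesis
        using plus_emeasure[of B "T (y, u)" "- B"] prob_space.emeasure_space_1[OF Ty(1)]
        by (simp add: sets_eq_imp_space_eq[OF Ty(2)])
    qed
    have "(\<integral>\<^sup>+u. emeasure (T (y, u)) B \<partial>\<nu> y) + (\<integral>\<^sup>+u. emeasure (T (y, u)) (- B) \<partial>\<nu> y) =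
        (\<integral>\<^sup>+u. emeasure (T (y, u)) B + emeasure (T (y, u)) (- B) \<partial>\<nu> y)"
      by (intro nn_integral_add[symmetric] meas) auto
    also have "\<dots> = 1" by (simp add: total emeasure_space_1)
    finally have "(\<integral>\<^sup>+u. emeasure (T (y, u)) B \<partial>\<nu> y) + (\<integral>\<^sup>+u. emeasure (T (y, u)) (- B) \<partial>\<nu> y) = 1" .
    with stay show ?thesis
      by (metis add.right_neutral add_left_mono antisym ennreal_add_left_cancel ennreal_one_neq_top
          infinity_ennreal_def le_iff_add)
  qed
  let ?P = "path_measure T \<pi> x"
  have P: "is_path_measure T \<pi> x ?P" by (rule is_path_measure_path_measure[OF D \<pi>])
  have sP: "sets ?P = sets path_space" and pP: "prob_space ?P" and x0: "AE \<omega> in ?P. fst (\<omega> 0) = x"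
    using P by (auto simp: is_path_measure_def)
  have spP: "space ?P = UNIV" by (simp add: sets_eq_imp_space_eq[OF sP])
  have state_P[measurable]: "(\<lambda>\<omega>. fst (\<omega> n)) \<in> ?P \<rightarrow>\<^sub>M borel" for n
    unfolding measurable_cong_sets[OF sP refl] by (rule measurable_state)
  have hist_P[measurable]: "hist n \<in> ?P \<rightarrow>\<^sub>M hist_space n" for n
    unfolding measurable_cong_sets[OF sP refl] by (rule measurable_hist)
  have stay: "AE \<omega> in ?P. fst (\<omega> n) \<in> B" for n
  proof (induction n)
    case 0
    show ?case using x0 by eventually_elim (simp add: x)
  next
    case (Suc n)
    let ?A = "{h \<in> space (hist_space n :: ('x, 'u) hist measure). snd h \<in> B}"
    have A[measurable]: "?A \<in> sets (hist_space n)" by measurable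
    have "(\<integral>\<^sup>+\<omega>. indicator ?A (hist n \<omega>) * indicator (- B) (fst (\<omega> (Suc n))) \<partial>?P) =
        (\<integral>\<^sup>+\<omega>. indicator ?A (hist n \<omega>) *
          (\<integral>\<^sup>+u. (\<integral>\<^sup>+y. indicator (- B) y \<partial>T (fst (\<omega> n), u)) \<partial>\<pi> n (hist n \<omega>)) \<partial>?P)"
      using \<pi> by (intro nn_integral_next_state[OF T _ P]) (auto simp: policies_def)
    also have "\<dots> = (\<integral>\<^sup>+\<omega>. 0 \<partial>?P)"
    proof (rule nn_integral_cong)
      fix \<omega> :: "('x, 'u) path"
      have "sets (T (fst (\<omega> n), u)) = sets borel" for u
        using measurable_space[OF T, of "(fst (\<omega> n), u)"] by (simp add: space_prob_algebra)
      then have "(\<integral>\<^sup>+y. indicator (- B) y \<partial>T (fst (\<omega> n), u)) = emeasure (T (fst (\<omega> n), u)) (- B)" for u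
        by (intro nn_integral_indicator) simp
      then show "indicator ?A (hist n \<omega>) *
          (\<integral>\<^sup>+u. (\<integral>\<^sup>+y. indicator (- B) y \<partial>T (fst (\<omega> n), u)) \<partial>\<pi> n (hist n \<omega>)) = 0"
        using leave[of "fst (\<omega> n)"] by (auto simp: \<pi>_def hist_def split: split_indicator)
    qed
    also have "\<dots> = 0" by simp
    finally have "AE \<omega> in ?P. indicator ?A (hist n \<omega>) * indicator (- B) (fst (\<omega> (Suc n))) = (0 :: ennreal)"
      by (subst (asm) nn_integral_0_iff_AE) simp_all
    with Suc.IH show ?case
    proof eventually_elim
      case (elim \<omega>)
      have "hist n \<omega> \<in> space (hist_space n)" using measurable_space[OF hist_P] by (simp add: spP)
      with elim show ?case by (auto simp: hist_def split: split_indicator_asm)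
    qed
  qed
  show "x \<in> viable_core K T S"
    unfolding viable_core_def
  proof (intro InterI, clarsimp)
    fix n
    have "always_event n S = {\<omega> \<in> space ?P. \<forall>k\<in>{..n}. fst (\<omega> k) \<in> S}"
      by (auto simp: always_event_def spP)
    also have "\<dots> \<in> sets ?P" using S by measurable
    finally have S_sets: "always_event n S \<in> sets ?P" .
    have "AE \<omega> in ?P. \<forall>k. fst (\<omega> k) \<in> B" using stay by (simp add: AE_all_countable)
    then have "AE \<omega> in ?P. \<omega> \<in> always_event n S"
      using B(2) by (auto simp: always_event_def elim!: eventually_mono)
    then have "M_val T \<pi> x (always_event n S) = 1"
      unfolding M_val_def using prob_space.emeasure_eq_1_AE[OF pP S_sets] by simp
    then have "1 \<le> M_sup K T x (always_event n S)"
      unfolding M_sup_def using \<pi> by (metis SUP_upper)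
    \<comment> \<open>All policies compete here, so their path measures must all be probability measures.\<close>
    moreover have "M_sup K T x (always_event n S) \<le> 1"
      unfolding M_sup_def M_val_def
    proof (rule SUP_least)
      fix \<sigma> assume "\<sigma> \<in> policies K"
      then have "prob_space (path_measure T \<sigma> x)"
        using is_path_measure_path_measure[OF D] by (auto simp: is_path_measure_def)
      then show "emeasure (path_measure T \<sigma> x) (always_event n S) \<le> 1"
        by (rule prob_space.measure_le_1)
    qed
    ultimately show "M_sup K T x (always_event n S) = 1" by (rule antisym[rotated])
  qed
qed

text \<open>On a weakly absorbing subset \<open>g\<close> vanishes, as it does on the whole viable core, whereas on the
  set in question \<open>g \<ge> \<epsilon>\<close>.\<close>

lemma simple_set_Diff_sublevel:
  assumes "cdt_MP K T" "\<pi>' \<in> policies K" "localized_on K T S g" "0 < \<epsilon>"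
  shows "simple_set K T (S - {x. g x < \<epsilon>})"
  unfolding simple_set_def
proof safe
  show "S - {x. g x < \<epsilon>} \<in> sets borel"
    using assms(3,4) by (intro sets.Diff) (auto simp: localized_on_def intro: borel_open)
  fix B x assume B: "B \<subseteq> S - {x. g x < \<epsilon>}" "weakly_absorbing K T B" and x: "x \<in> B"
  have "B \<subseteq> viable_core K T S"
    using B assms(3) by (intro weakly_absorbing_subset_viable_core[OF assms(1,2)]) (auto simp: localized_on_def)
  with x have "g x = 0" using assms(3) by (auto simp: localized_on_def)
  with x B(1) assms(4) show "x \<in> {}" by auto
qed

section \<open>The excessivity bounds\<close>

theorem theorem6:
  fixes K :: "('x :: second_countable_topology \<times> 'u :: second_countable_topology) set"
    and T :: "'x \<times> 'u \<Rightarrow> 'x measure"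
    and S G :: "'x set"
    and g_up g_lo :: "'x \<Rightarrow> real"
    and \<pi>' :: "('x, 'u) policy"
    and \<epsilon> :: real
  assumes "continuous_cdt_MP K T"
    and "compact S"
    and "G \<in> sets borel"
    and "S \<inter> G = {}"
    and "\<And>x. M_sup K T x (until_event S G) = (SUP \<pi> \<in> stationary_policies K. M_val T \<pi> x (until_event S G))"
    and "\<And>x. M_inf K T x (until_event S G) = (INF \<pi> \<in> stationary_policies K. M_val T \<pi> x (until_event S G))"
    and "locally_uniformly_excessive_on K T S g_up"
    and "\<pi>' \<in> stationary_policies K"
    and "locally_excessive_on K T S (initial_kernel \<pi>') g_lo"
    and "0 < \<epsilon>" and "\<epsilon> \<le> 1"
  shows "chi_sup K T S G {x. g_up x < \<epsilon>} \<le> ennreal \<epsilon> \<and>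
         chi_inf K T S G {x. g_lo x < \<epsilon>} \<le> ennreal \<epsilon> \<and>
         simple_set K T (S - {x. g_up x < \<epsilon>}) \<and>
         simple_set K T (S - {x. g_lo x < \<epsilon>})"
proof -
  have D: "cdt_MP K T" and K: "closed K" and T: "T \<in> borel \<rightarrow>\<^sub>M prob_algebra borel"
    using assms(1) by (auto simp: continuous_cdt_MP_def cdt_MP_def)
  have up: "locally_uniformly_excessive K T g_up" "localized_on K T S g_up"
    using assms(7) by (auto simp: locally_uniformly_excessive_on_def)
  have lo: "locally_excessive K T (initial_kernel \<pi>') g_lo" "localized_on K T S g_lo"
    using assms(9) by (auto simp: locally_excessive_on_def)
  have \<pi>': "\<pi>' \<in> policies K" using assms(8) by (simp add: stationary_policies_def)
  have "chi_sup K T S G {x. g_up x < \<epsilon>} \<le> ennreal \<epsilon>"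
    unfolding chi_sup_def
  proof (intro SUP_least)
    fix \<pi> y assume "\<pi> \<in> stationary_policies K" and y: "y \<in> {x. g_up x < \<epsilon>}"
    then have \<pi>: "\<pi> \<in> policies K" by (simp add: stationary_policies_def)
    have "M_val T \<pi> y (until_event S G) \<le> ennreal (g_up y)"
    proof (rule M_val_until_le[OF D \<pi> _ up(2) assms(4)])
      show "bounded_nonneg_borel g_up" using up(1) by (simp add: locally_uniformly_excessive_def)
      show "(\<integral>\<^sup>+u. (\<integral>\<^sup>+y. ennreal (g_up y) \<partial>T (snd h, u)) \<partial>\<pi> n h) \<le> ennreal (g_up (snd h))"
        if "h \<in> space (hist_space n)" "g_up (snd h) \<le> 1" for n h
        using \<pi> that universal_kernel_prob[of "hist_space n" borel "\<pi> n" h]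
        by (intro locally_uniformly_excessive_nn_integral[OF T K up(1)]) (auto simp: policies_def)
    qed
    also have "\<dots> \<le> ennreal \<epsilon>" using y by (intro ennreal_leI) simp
    finally show "M_val T \<pi> y (until_event S G) \<le> ennreal \<epsilon>" .
  qed
  moreover have "chi_inf K T S G {x. g_lo x < \<epsilon>} \<le> ennreal \<epsilon>"
    unfolding chi_inf_def
  proof (intro INF_lower2[OF assms(8)] SUP_least)
    fix y assume y: "y \<in> {x. g_lo x < \<epsilon>}"
    have "M_val T \<pi>' y (until_event S G) \<le> ennreal (g_lo y)"
    proof (rule M_val_until_le[OF D \<pi>' _ lo(2) assms(4)])
      show "bounded_nonneg_borel g_lo" using lo(1) by (simp add: locally_excessive_def)
      show "(\<integral>\<^sup>+u. (\<integral>\<^sup>+y. ennreal (g_lo y) \<partial>T (snd h, u)) \<partial>\<pi>' n h) \<le> ennreal (g_lo (snd h))"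
        if "h \<in> space (hist_space n)" "g_lo (snd h) \<le> 1" for n h
        using locally_excessive_nn_integral[OF T lo(1) that(2)] assms(8) that(1)
        by (simp add: stationary_policies_def)
    qed
    also have "\<dots> \<le> ennreal \<epsilon>" using y by (intro ennreal_leI) simp
    finally show "M_val T \<pi>' y (until_event S G) \<le> ennreal \<epsilon>" .
  qed
  ultimately show ?thesis
    using simple_set_Diff_sublevel[OF D \<pi>' up(2) assms(10)]
      simple_set_Diff_sublevel[OF D \<pi>' lo(2) assms(10)] by blast
qed

end
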